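(* Let $\mathcal{I}=(\mathcal{V},\mathcal{E},\mathcal{B},\mathcal{S}=\{s\},\mathcal{T}=\{t\})$ be a network instance with a single source $s$ and a single terminal $t$ that is $d$-vertex connected from $s$; let $\ell_o,\ell_e,\ell_{oe}\ge 0$ be integers and let $$\mathcal{B}=\{(\beta_o,\beta_e,\beta_{oe}) : \beta_o,\beta_e,\beta_{oe}\subset\mathcal{V}\setminus\{s\}\text{ pairwise disjoint},\ |\beta_o|\le\ell_o,\ |\beta_e|\le\ell_e,\ |\beta_{oe}|\le\ell_{oe}\}.$$ Then the (perfectly) secure message capacity from $s$ to $t$ is given by $$C_{\mathrm{add}}=\begin{cases} d-\ell_o-\ell_e-2\ell_{oe}, & \text{if } d>\ell_o+\ell_e+2\ell_{oe},\\ 0,&\text{otherwise,}\end{cases}$$ under the additive jamming model, and $$C_{\mathrm{ow}}=\begin{cases} d-\ell_o-\ell_e-2\ell_{oe}, & \text{if } d>\ell_o+2\ell_e+2\ell_{oe},\\ 0,&\text{otherwise,}\end{cases}$$ under the overwrite jamming model. Here the adversary may base its corruptions on the information available at any node of $\beta_{\mathrm{obs}}=\beta_o\cup\beta_{oe}$, irrespective of topological order.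
   Context: **Network.** The network is a finite directed acyclic graph $\mathcal{G}=(\mathcal{V},\mathcal{E})$ (parallel edges allowed); the source $s$ has no incoming edges and the terminal $t$ has no outgoing edges. All operations are over a finite field $\mathbb{F}_q$, whose size $q$ is a design parameter of the code; each edge carries one symbol of $\mathbb{F}_q$ per network use, so with blocklength $N$ (number of network uses) every edge transmission is a vector in $\mathbb{F}_q^N$. The source holds a message and an unlimited supply of independent uniform symbols of $\mathbb{F}_q$; no other node has randomness. **Codes.** A code consists of an encoding function $f_e$ for each edge $e$ and a decoding function $g_t$ for $t$. The symbol $X_{u\to v}$ sent on $e=(u,v)$ is $f_e$ applied to the information $X_u$ available at $u$: the message and randomness if $u=s$, and otherwise the tuple $(Y_{w\to u}:(w,u)\in\mathcal{E})$ of (possibly corrupted) received symbols. **Adversary.** A configuration $\beta=(\beta_o,\beta_e,\beta_{oe})\in\mathcal{B}$ consists of pairwise disjoint sets of nodes which are, respectively, observed, corrupted, and both observed and corrupted. Put $\beta_{\mathrm{obs}}=\beta_o\cup\beta_{oe}$, $\beta_{\mathrm{jam}}=\beta_e\cup\beta_{oe}$. For an edge $(u,v)$ with $u\notin\beta_{\mathrm{jam}}$, $Y_{u\to v}=X_{u\to v}$. For $u\in\beta_{\mathrm{jam}}$ the adversary chooses $Z_{u\to v}$, and $Y_{u\to v}=X_{u\to v}+Z_{u\to v}$ in the *additive jamming* model, while $Y_{u\to v}=Z_{u\to v}$ in the *overwrite jamming* model. The adversary is computationally unbounded, knows the topology and the code, may choose any $\beta\in\mathcal{B}$, and may choose the injected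 symbols as any function of the topology, the code, and the information available at the nodes of $\beta_{\mathrm{obs}}$ (strategies are assumed to produce well-defined transmissions). **Secure message capacity.** A value $C$ is the secure message capacity from $s$ to $t$ in the following sense: for every $\epsilon>0$ and $\gamma>0$ there exist a finite blocklength $N$ and a code (over a suitable field $\mathbb{F}_q$) for a message $K$ with rate $H(K)/N\ge C-\gamma$ ($H$ is entropy in base $q$, $K$ uniform over its alphabet and independent of the source's additional randomness), such that for every $\beta\in\mathcal{B}$ and every adversarial strategy: (Reliability) the estimate $\hat K=g_t(Y_t)$ formed from the symbols $Y_t$ received by $t$ satisfies $\Pr(\hat K\neq K)\le\epsilon$; (Perfect secrecy) if $t\notin\beta_{\mathrm{obs}}$, then $I(K;\{X_v:v\in\beta_{\mathrm{obs}}\})=0$. **$d$-vertex connectivity.** A node $v$ is $d$-vertex connected from $s$ if for some integer $0\le b\le d$ there are at least $b$ paths from $s$ to $v$, each with at least one intermediate node and pairwise sharing no vertices other than $s$ and $v$, and in addition at least $d-b$ edges from $s$ to $v$.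
   Formalization: The adversary's corruptions may depend on the information at every observed node except the terminal t itself; if t is observed, its received symbols cannot be used to choose the injected symbols (with such feedback the claimed values fail, e.g. d=4, l_o=l_oe=1, l_e=0). *)

theory Defs
  imports
    "Graph_Theory.Graph_Theory"
    "HOL-Algebra.Ring"
    "HOL-Probability.Probability"
begin

locale network = fin_digraph G for G :: "('v, 'e) pre_digraph" (structure) +
  fixes s t :: 'v
  assumes source_in_verts: "s \<in> verts G"
    and terminal_in_verts: "t \<in> verts G"
    and acyclic: "acyclic (arcs_ends G)"
    and source_no_in_arcs: "in_arcs G s = {}"
    and terminal_no_out_arcs: "out_arcs G t = {}"

(* A path is the list of its arcs, so length p \<ge> 2 says that it has an intermediate node. *)
definition vertex_connected :: "('v, 'e) pre_digraph \<Rightarrow> 'v \<Rightarrow> 'v \<Rightarrow> nat \<Rightarrow> bool" where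
  "vertex_connected G s v d \<longleftrightarrow>
     (\<exists>b\<le>d.
        (\<exists>P. finite P \<and> b \<le> card P \<and>
           (\<forall>p\<in>P. pre_digraph.apath G s p v \<and> 2 \<le> length p) \<and>
           (\<forall>p\<in>P. \<forall>p'\<in>P. p \<noteq> p' \<longrightarrow>
              set (pre_digraph.awalk_verts G s p) \<inter> set (pre_digraph.awalk_verts G s p') \<subseteq> {s, v})) \<and>
        d - b \<le> card {e \<in> arcs G. tail G e = s \<and> head G e = v})"


type_synonym 'v config = "'v set \<times> 'v set \<times> 'v set"

fun obs_nodes :: "'v config \<Rightarrow> 'v set" where
  "obs_nodes (\<beta>o, \<beta>e, \<beta>oe) = \<beta>o \<union> \<beta>oe"

fun jam_nodes :: "'v config \<Rightarrow> 'v set" where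
  "jam_nodes (\<beta>o, \<beta>e, \<beta>oe) = \<beta>e \<union> \<beta>oe"

definition configs :: "('v, 'e) pre_digraph \<Rightarrow> 'v \<Rightarrow> nat \<Rightarrow> nat \<Rightarrow> nat \<Rightarrow> 'v config set" where
  "configs G s l_o l_e l_oe =
     {(\<beta>o, \<beta>e, \<beta>oe).
        \<beta>o \<subseteq> verts G - {s} \<and> \<beta>e \<subseteq> verts G - {s} \<and> \<beta>oe \<subseteq> verts G - {s} \<and>
        \<beta>o \<inter> \<beta>e = {} \<and> \<beta>o \<inter> \<beta>oe = {} \<and> \<beta>e \<inter> \<beta>oe = {} \<and>
        card \<beta>o \<le> l_o \<and> card \<beta>e \<le> l_e \<and> card \<beta>oe \<le> l_oe}"


(* The field is part of the code. HOL cannot quantify over types inside a formula, so the field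
   is a HOL-Algebra ring with an explicit carrier of integers; every finite field has an
   isomorphic copy of this form. Its operations are unrelated to those of int. In the same way
   the (finite) message alphabet is a set of naturals. *)
type_synonym symbols = "nat \<Rightarrow> int"

definition vecs :: "int ring \<Rightarrow> nat \<Rightarrow> symbols set" where
  "vecs F n = {..<n} \<rightarrow>\<^sub>E carrier F"

definition vec_add :: "int ring \<Rightarrow> nat \<Rightarrow> symbols \<Rightarrow> symbols \<Rightarrow> symbols" where
  "vec_add F n x y = (\<lambda>i\<in>{..<n}. x i \<oplus>\<^bsub>F\<^esub> y i)"

(* src_enc e is the encoding function of an edge leaving the source; its argument is the message
   together with the source's random symbols. rlen is the number of random symbols the code
   draws; the supply is unlimited in that codes may choose it freely. relay_enc e is the encoding
   function of every other edge; its argument is the tuple received at the tail of e. *)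
record 'e net_code =
  fld :: "int ring"
  blen :: nat
  rlen :: nat
  msgs :: "nat set"
  src_enc :: "'e \<Rightarrow> nat \<times> symbols \<Rightarrow> symbols"
  relay_enc :: "'e \<Rightarrow> ('e \<Rightarrow> symbols) \<Rightarrow> symbols"
  decode :: "('e \<Rightarrow> symbols) \<Rightarrow> nat"

abbreviation edge_vecs :: "'e net_code \<Rightarrow> symbols set" where
  "edge_vecs c \<equiv> vecs (fld c) (blen c)"

definition source_data :: "'e net_code \<Rightarrow> (nat \<times> symbols) set" where
  "source_data c = msgs c \<times> vecs (fld c) (rlen c)"

definition valid_code :: "('v, 'e) pre_digraph \<Rightarrow> 'v \<Rightarrow> 'v \<Rightarrow> 'e net_code \<Rightarrow> bool" where
  "valid_code G s t c \<longleftrightarrow>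
     field (fld c) \<and> finite (carrier (fld c)) \<and> 0 < blen c \<and>
     finite (msgs c) \<and> msgs c \<noteq> {} \<and>
     (\<forall>e\<in>out_arcs G s. src_enc c e \<in> source_data c \<rightarrow> edge_vecs c) \<and>
     (\<forall>e\<in>arcs G - out_arcs G s.
        relay_enc c e \<in> (in_arcs G (tail G e) \<rightarrow>\<^sub>E edge_vecs c) \<rightarrow> edge_vecs c) \<and>
     decode c \<in> (in_arcs G t \<rightarrow>\<^sub>E edge_vecs c) \<rightarrow> msgs c"


datatype jamming = Additive | Overwrite

(* The information X_v of a node v other than the source. *)
definition node_info :: "('v, 'e) pre_digraph \<Rightarrow> ('e \<Rightarrow> symbols) \<Rightarrow> 'v \<Rightarrow> 'e \<Rightarrow> symbols" where
  "node_info G Y v = restrict Y (in_arcs G v)"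

definition nodes_info ::
    "('v, 'e) pre_digraph \<Rightarrow> ('e \<Rightarrow> symbols) \<Rightarrow> 'v set \<Rightarrow> 'v \<Rightarrow> 'e \<Rightarrow> symbols" where
  "nodes_info G Y A = (\<lambda>v\<in>A. node_info G Y v)"

definition sent ::
    "('v, 'e) pre_digraph \<Rightarrow> 'v \<Rightarrow> 'e net_code \<Rightarrow> nat \<times> symbols \<Rightarrow> ('e \<Rightarrow> symbols) \<Rightarrow> 'e \<Rightarrow> symbols" where
  "sent G s c \<omega> Y e =
     (if tail G e = s then src_enc c e \<omega> else relay_enc c e (node_info G Y (tail G e)))"

fun jam :: "jamming \<Rightarrow> 'e net_code \<Rightarrow> symbols \<Rightarrow> symbols \<Rightarrow> symbols" where
  "jam Additive c x z = vec_add (fld c) (blen c) x z"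
| "jam Overwrite c x z = z"

(* A strategy is a map from what the adversary observes to the injected symbols Z_e. *)
type_synonym ('v, 'e) strategy = "('v \<Rightarrow> 'e \<Rightarrow> symbols) \<Rightarrow> 'e \<Rightarrow> symbols"

(* The nodes whose information the injected symbols may depend on: all observed nodes, wherever
   they lie in the network, except for the terminal. The information at the terminal is the outcome
   of all transmissions; an adversary that could choose its injections after seeing that outcome
   would defeat the capacity formulas already for four disjoint two-edge paths
   s -> v_i -> t with l_o = l_oe = 1 and l_e = 0: observing t and jamming an observed v_1, it
   replaces the symbol from v_1 to t by that of an independently resampled message and randomness
   that agree with what t receives from v_3 and v_4. Secrecy against pairs of nodes makes the
   resampled message independent of the true one, and t cannot tell this from v_2 being
   the jammed node. *)
definition feedback_nodes :: "'v \<Rightarrow> 'v config \<Rightarrow> 'v set" where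
  "feedback_nodes t \<beta> = obs_nodes \<beta> - {t}"

definition transmission ::
    "jamming \<Rightarrow> ('v, 'e) pre_digraph \<Rightarrow> 'v \<Rightarrow> 'v \<Rightarrow> 'e net_code \<Rightarrow> 'v config \<Rightarrow> ('v, 'e) strategy
     \<Rightarrow> nat \<times> symbols \<Rightarrow> ('e \<Rightarrow> symbols) \<Rightarrow> bool" where
  "transmission J G s t c \<beta> \<phi> \<omega> Y \<longleftrightarrow>
     Y \<in> arcs G \<rightarrow>\<^sub>E edge_vecs c \<and>
     (\<forall>e\<in>arcs G. Y e =
        (if tail G e \<in> jam_nodes \<beta>
         then jam J c (sent G s c \<omega> Y e) (\<phi> (nodes_info G Y (feedback_nodes t \<beta>)) e)
         else sent G s c \<omega> Y e))"

(* Observations need not precede injections in the network, so the equations for the received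
   symbols may be circular; well-definedness of the transmissions means that they have exactly one
   solution for each value of the source's data. *)
definition valid_strategy ::
    "jamming \<Rightarrow> ('v, 'e) pre_digraph \<Rightarrow> 'v \<Rightarrow> 'v \<Rightarrow> 'e net_code \<Rightarrow> 'v config \<Rightarrow> ('v, 'e) strategy \<Rightarrow> bool" where
  "valid_strategy J G s t c \<beta> \<phi> \<longleftrightarrow>
     (\<forall>I \<in> (\<Pi>\<^sub>E v\<in>feedback_nodes t \<beta>. in_arcs G v \<rightarrow>\<^sub>E edge_vecs c).
        \<forall>e\<in>arcs G. tail G e \<in> jam_nodes \<beta> \<longrightarrow> \<phi> I e \<in> edge_vecs c) \<and>
     (\<forall>\<omega>\<in>source_data c. \<exists>!Y. transmission J G s t c \<beta> \<phi> \<omega> Y)"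

definition received ::
    "jamming \<Rightarrow> ('v, 'e) pre_digraph \<Rightarrow> 'v \<Rightarrow> 'v \<Rightarrow> 'e net_code \<Rightarrow> 'v config \<Rightarrow> ('v, 'e) strategy
     \<Rightarrow> nat \<times> symbols \<Rightarrow> 'e \<Rightarrow> symbols" where
  "received J G s t c \<beta> \<phi> \<omega> = (THE Y. transmission J G s t c \<beta> \<phi> \<omega> Y)"


(* Under this measure the message is uniform on its alphabet, the random symbols are independent
   and uniform on the field, and both are independent of each other. *)
definition source_measure :: "'e net_code \<Rightarrow> (nat \<times> symbols) measure" where
  "source_measure c = uniform_count_measure (source_data c)"

abbreviation field_size :: "'e net_code \<Rightarrow> real" where
  "field_size c \<equiv> real (card (carrier (fld c)))"

(* Spelled out forms of the notations for entropy and mutual information of discrete random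
   variables that the library offers only inside the locale information_space. *)
definition code_entropy :: "'e net_code \<Rightarrow> (nat \<times> symbols \<Rightarrow> 'b) \<Rightarrow> real" where
  "code_entropy c X =
     prob_space.entropy (source_measure c) (field_size c)
       (count_space (X ` space (source_measure c))) X"

definition code_mutual_information ::
    "'e net_code \<Rightarrow> (nat \<times> symbols \<Rightarrow> 'b) \<Rightarrow> (nat \<times> symbols \<Rightarrow> 'c) \<Rightarrow> real" where
  "code_mutual_information c X Y =
     prob_space.mutual_information (source_measure c) (field_size c)
       (count_space (X ` space (source_measure c)))
       (count_space (Y ` space (source_measure c))) X Y"

definition rate :: "'e net_code \<Rightarrow> real" where
  "rate c = code_entropy c fst / real (blen c)"

definition reliable ::
    "jamming \<Rightarrow> ('v, 'e) pre_digraph \<Rightarrow> 'v \<Rightarrow> 'v \<Rightarrow> 'e net_code \<Rightarrow> 'v config \<Rightarrow> ('v, 'e) strategy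
     \<Rightarrow> real \<Rightarrow> bool" where
  "reliable J G s t c \<beta> \<phi> \<epsilon> \<longleftrightarrow>
     measure (source_measure c)
       {\<omega> \<in> space (source_measure c).
          decode c (node_info G (received J G s t c \<beta> \<phi> \<omega>) t) \<noteq> fst \<omega>} \<le> \<epsilon>"

definition perfectly_secret ::
    "jamming \<Rightarrow> ('v, 'e) pre_digraph \<Rightarrow> 'v \<Rightarrow> 'v \<Rightarrow> 'e net_code \<Rightarrow> 'v config \<Rightarrow> ('v, 'e) strategy \<Rightarrow> bool" where
  "perfectly_secret J G s t c \<beta> \<phi> \<longleftrightarrow>
     code_mutual_information c fst
       (\<lambda>\<omega>. nodes_info G (received J G s t c \<beta> \<phi> \<omega>) (obs_nodes \<beta>)) = 0"

definition secure_message_capacity ::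
    "jamming \<Rightarrow> ('v, 'e) pre_digraph \<Rightarrow> 'v config set \<Rightarrow> 'v \<Rightarrow> 'v \<Rightarrow> real \<Rightarrow> bool" where
  "secure_message_capacity J G B s t C \<longleftrightarrow>
     (\<forall>\<epsilon>>0. \<forall>\<gamma>>0. \<exists>c :: 'e net_code.
        valid_code G s t c \<and> C - \<gamma> \<le> rate c \<and>
        (\<forall>\<beta>\<in>B. \<forall>\<phi>. valid_strategy J G s t c \<beta> \<phi> \<longrightarrow>
           reliable J G s t c \<beta> \<phi> \<epsilon> \<and>
           (t \<notin> obs_nodes \<beta> \<longrightarrow> perfectly_secret J G s t c \<beta> \<phi>)))"

end

theory Submission
  imports Defs "HOL-Number_Theory.Residues" "HOL-Computational_Algebra.Polynomial"
begin

text \<open>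
  Packet \<open>i\<close> travels along the \<open>i\<close>-th of \<open>d\<close> vertex-disjoint paths, all other arcs carry zero. A node meets
  at most one path, so the adversary sees at most \<open>z = \<ell>\<^sub>o + \<ell>\<^sub>o\<^sub>e\<close> packets and alters at most
  \<open>w = \<ell>\<^sub>e + \<ell>\<^sub>o\<^sub>e\<close>. The packets are \<open>L\<close> parallel Reed-Solomon shares with \<open>z\<close> random low and
  \<open>R = d - z - w\<close> message coefficients, so \<open>z\<close> of them reveal nothing and any \<open>d - w\<close> determine the message.

  Every packet also holds a fresh key and a mask for each other packet, the masked polynomial hashes of its
  own share under the others' keys, and an algebraic manipulation detection code protecting its share and
  keys. Without seeing packet \<open>j\<close> one cannot alter packet \<open>i\<close> so that key \<open>j\<close> still accepts it, and an additive
  change of an unseen packet is noticed by the packet itself. The decoder looks for \<open>d - w\<close> packets that are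
  consistent in themselves and accept each other; the unaltered packets are such a set. Under additive jamming
  any such set is larger than \<open>z\<close>, so it contains an unseen, hence genuine, packet, which vouches for
  all others. Under overwrite jamming it exceeds the at most \<open>\<ell>\<^sub>o + \<ell>\<^sub>e + \<ell>\<^sub>o\<^sub>e\<close> packets the adversary touches
  once \<open>d > \<ell>\<^sub>o + 2 \<ell>\<^sub>e + 2 \<ell>\<^sub>o\<^sub>e\<close>, so it contains an untouched one. The overhead of \<open>3 d + 2\<close> symbols per packet is
  negligible for large \<open>L\<close>, and the failure probability is of order \<open>1 / p\<close> over the field of prime order \<open>p\<close>.
\<close>

section \<open>Polynomials over a prime field\<close>

text \<open>Lagrange's root bound, proved over the integers: \<open>[:p:] dvd Q\<close> says that
  \<open>Q\<close> vanishes modulo \<open>p\<close>, and \<open>degree\<close> is the integer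
  degree. Splitting off a root \<open>r\<close> leaves the remainder \<open>poly Q r\<close>, a
  multiple of \<open>p\<close>, so the quotient still does not vanish modulo
  \<open>p\<close>.\<close>

lemma card_roots_mod_prime:
  fixes p :: int and Q :: "int poly"
  assumes p: "prime p" and "\<not> [:p:] dvd Q"
  shows "card {x \<in> {0..<p}. p dvd poly Q x} \<le> degree Q"
  using assms(2)
proof (induction "degree Q" arbitrary: Q)
  case 0
  then obtain a where Q: "Q = [:a:]" by (metis degree_0_id)
  then have "\<not> p dvd a" using 0 by simp
  then show ?case using Q by simp
next
  case (Suc n)
  show ?case
  proof (cases "{x \<in> {0..<p}. p dvd poly Q x} = {}")
    case False
    then obtain r where r: "r \<in> {0..<p}" "p dvd poly Q r" by auto
    define q where "q = synthetic_div Q r"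
    have Q: "Q = [:-r, 1:] * q + [:poly Q r:]"
      unfolding q_def using synthetic_div_correct' [of r Q] by simp
    have dq: "degree q = n" using Suc.hyps(2) by (simp add: q_def degree_synthetic_div)
    have "\<not> [:p:] dvd q"
    proof
      assume "[:p:] dvd q"
      moreover have "[:p:] dvd [:poly Q r:]" using r by simp
      ultimately have "[:p:] dvd [:-r, 1:] * q + [:poly Q r:]" by (meson dvd_add dvd_mult)
      with Q Suc.prems show False by simp
    qed
    then have IH: "card {x \<in> {0..<p}. p dvd poly q x} \<le> n" using Suc.hyps(1) dq by blast
    have "{x \<in> {0..<p}. p dvd poly Q x} \<subseteq> insert r {x \<in> {0..<p}. p dvd poly q x}"
    proof
      fix x assume x: "x \<in> {x \<in> {0..<p}. p dvd poly Q x}"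
      have "poly Q x = (x - r) * poly q x + poly Q r" by (subst Q) (simp add: algebra_simps)
      then have "p dvd (x - r) * poly q x" using x r by (auto simp: dvd_add_left_iff)
      then have "p dvd x - r \<or> p dvd poly q x" using p by (simp add: prime_dvd_mult_iff)
      moreover have "x = r" if "p dvd x - r"
        using that x r by (metis (no_types, lifting) atLeastLessThan_iff mem_Collect_eq mod_eq_dvd_iff mod_pos_pos_trivial)
      ultimately show "x \<in> insert r {x \<in> {0..<p}. p dvd poly q x}" using x by auto
    qed
    then have "card {x \<in> {0..<p}. p dvd poly Q x} \<le> card (insert r {x \<in> {0..<p}. p dvd poly q x})"
      by (intro card_mono) (auto intro: finite_subset[of _ "{0..<p}"])
    also have "\<dots> \<le> Suc n" using IH by (intro order_trans[OF card_insert_le_m1]) (auto simp: card_insert_if)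
    finally show ?thesis using Suc.hyps(2) by simp
  next
    case True
    then show ?thesis by (simp only: card.empty)
  qed
qed

lemma card_sum_roots_mod_prime:
  fixes p :: int and c :: "nat \<Rightarrow> int"
  assumes p: "prime p" and k: "k \<le> n" "\<not> p dvd c k"
  shows "card {x \<in> {0..<p}. p dvd (\<Sum>k\<le>n. c k * x ^ k)} \<le> n"
proof -
  define Q where "Q = (\<Sum>k\<le>n. Polynomial.monom (c k) k)"
  have ev: "poly Q x = (\<Sum>k\<le>n. c k * x ^ k)" for x
    by (simp add: Q_def poly_sum poly_monom)
  have "Polynomial.coeff Q k = c k"
    using k(1) by (simp add: Q_def coeff_sum)
  then have "\<not> [:p:] dvd Q" using k(2) unfolding const_poly_dvd_iff by metis
  then have "card {x \<in> {0..<p}. p dvd poly Q x} \<le> degree Q" by (rule card_roots_mod_prime[OF p])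
  also have "degree Q \<le> n" unfolding Q_def
    by (rule degree_sum_le) (auto intro: order_trans[OF degree_monom_le])
  finally show ?thesis by (simp add: ev)
qed

lemma poly_eq_sum_lessThan:
  fixes Q :: "'a :: comm_semiring_1 poly"
  assumes "Q = 0 \<or> degree Q < n"
  shows "poly Q x = (\<Sum>k<n. Polynomial.coeff Q k * x ^ k)"
proof (cases "Q = 0")
  case False
  with assms have "degree Q < n" by simp
  then show ?thesis unfolding poly_altdef
    by (intro sum.mono_neutral_left) (auto simp: coeff_eq_0)
qed simp

text \<open>Newton interpolation: each new node adds a multiple of the product \<open>W\<close>,
  which vanishes at the earlier nodes and is invertible at the new one because nodes are distinct
  residues. The alternative \<open>Q = 0\<close> covers the empty node set, where no degree is small
  enough.\<close>

lemma interpolation_mod_prime: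
  fixes p :: int and v :: "int \<Rightarrow> int"
  assumes p: "prime p" and "finite A" "A \<subseteq> {0..<p}"
  shows "\<exists>Q :: int poly. (Q = 0 \<or> degree Q < card A) \<and> (\<forall>x\<in>A. [poly Q x = v x] (mod p))"
  using assms(2,3)
proof (induction rule: finite_induct)
  case empty
  then show ?case by auto
next
  case (insert a A)
  then obtain Q :: "int poly" where Q: "Q = 0 \<or> degree Q < card A" "\<forall>x\<in>A. [poly Q x = v x] (mod p)" by auto
  define W :: "int poly" where "W = (\<Prod>x\<in>A. [:-x, 1:])"
  have dW: "degree W = card A"
    unfolding W_def by (subst degree_prod_sum_eq) auto
  have "\<not> p dvd a - x" if "x \<in> A" for x
  proof
    assume "p dvd a - x"
    then have "a mod p = x mod p" by (simp add: mod_eq_dvd_iff)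
    moreover have "x \<in> {0..<p}" "a \<in> {0..<p}" using insert.prems that by auto
    ultimately show False using insert.hyps(2) that by (auto)
  qed
  then have "\<not> p dvd poly W a"
    using p insert.hyps(1) by (auto simp: W_def poly_prod prime_dvd_prod_iff)
  then have "coprime (poly W a) p" using p by (meson coprime_commute prime_imp_coprime)
  then obtain u where u: "[poly W a * u = 1] (mod p)" using cong_solve_coprime_int by blast
  define c where "c = u * (v a - poly Q a)"
  define Q' where "Q' = Q + Polynomial.smult c W"
  have "Q' = 0 \<or> degree Q' < card (insert a A)"
    using Q(1) dW insert.hyps
    by (auto simp: Q'_def intro!: le_imp_less_Suc degree_add_le intro: order_trans[OF degree_smult_le])
  moreover have "[poly Q' x = v x] (mod p)" if "x \<in> insert a A" for x
  proof (cases "x = a")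
    case True
    have "[poly Q a + (poly W a * u) * (v a - poly Q a) = poly Q a + 1 * (v a - poly Q a)] (mod p)"
      by (intro cong_add cong_mult u) auto
    then show ?thesis using True by (simp add: Q'_def c_def algebra_simps)
  next
    case False
    then have "x \<in> A" using that by auto
    then have "poly W x = 0" using insert.hyps by (auto simp: W_def poly_prod)
    then show ?thesis using Q(2) \<open>x \<in> A\<close> by (simp add: Q'_def)
  qed
  ultimately show ?case by blast
qed

text \<open>Each \<open>\<sigma> x\<close> permutes the sample space, so the bad points can be counted orbit by orbit.\<close>
lemma card_bad_le_if_orbits:
  fixes \<sigma> :: "'x \<Rightarrow> 'a \<Rightarrow> 'a"
  assumes "finite \<Omega>" "finite X"
    and inj: "\<And>x. x \<in> X \<Longrightarrow> inj_on (\<sigma> x) \<Omega>"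
    and into: "\<And>x. x \<in> X \<Longrightarrow> \<sigma> x ` \<Omega> \<subseteq> \<Omega>"
    and le: "\<And>\<omega>. \<omega> \<in> \<Omega> \<Longrightarrow> card {x \<in> X. P (\<sigma> x \<omega>)} \<le> k"
  shows "card {\<omega> \<in> \<Omega>. P \<omega>} * card X \<le> k * card \<Omega>"
proof -
  have eq: "card {\<omega> \<in> \<Omega>. P (\<sigma> x \<omega>)} = card {\<omega> \<in> \<Omega>. P \<omega>}" if x: "x \<in> X" for x
  proof -
    have "\<sigma> x ` \<Omega> = \<Omega>" using endo_inj_surj[OF assms(1) into[OF x] inj[OF x]] .
    then have "\<sigma> x ` {\<omega> \<in> \<Omega>. P (\<sigma> x \<omega>)} = {\<omega> \<in> \<Omega>. P \<omega>}" by auto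
    moreover have "inj_on (\<sigma> x) {\<omega> \<in> \<Omega>. P (\<sigma> x \<omega>)}" using inj[OF x] by (rule inj_on_subset) auto
    ultimately show ?thesis by (metis card_image)
  qed
  have ind: "(\<Sum>\<omega>\<in>\<Omega>. if Q \<omega> then 1 else 0) = card {\<omega> \<in> \<Omega>. Q \<omega>}" for Q
    using assms(1) by (simp add: sum.If_cases Int_def)
  have ind': "(\<Sum>x\<in>X. if Q x then 1 else 0) = card {x \<in> X. Q x}" for Q
    using assms(2) by (simp add: sum.If_cases Int_def)
  \<comment> \<open>The pairs of \<open>x\<close> and \<open>\<omega>\<close> with
    \<open>P (\<sigma> x \<omega>)\<close> are counted in both orders.\<close>
  have "card {\<omega> \<in> \<Omega>. P \<omega>} * card X = (\<Sum>x\<in>X. card {\<omega> \<in> \<Omega>. P (\<sigma> x \<omega>)})"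
    by (simp add: eq)
  also have "\<dots> = (\<Sum>x\<in>X. \<Sum>\<omega>\<in>\<Omega>. if P (\<sigma> x \<omega>) then 1 else 0)"
    by (simp add: ind)
  also have "\<dots> = (\<Sum>\<omega>\<in>\<Omega>. card {x \<in> X. P (\<sigma> x \<omega>)})"
    by (subst sum.swap) (simp add: ind')
  also have "\<dots> \<le> (\<Sum>\<omega>\<in>\<Omega>. k)" by (intro sum_mono le)
  finally show ?thesis by (simp add: mult.commute)
qed

section \<open>Information\<close>

lemma information_space_uniform_count_measure:
  assumes "finite \<Omega>" "\<Omega> \<noteq> {}" "1 < b"
  shows "information_space (uniform_count_measure \<Omega>) b"
  using prob_space_uniform_count_measure[OF assms(1,2)] assms(3)
  by (simp add: information_space_def information_space_axioms_def)

lemma simple_function_uniform_count_measure: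
  assumes "finite \<Omega>"
  shows "simple_function (uniform_count_measure \<Omega>) X"
  using assms by (auto simp: simple_function_def space_uniform_count_measure sets_uniform_count_measure)

lemma entropy_fst_uniform:
  fixes V :: "'b set"
  assumes "finite M" "finite V" "M \<noteq> {}" "V \<noteq> {}" "1 < b"
  defines "S \<equiv> uniform_count_measure (M \<times> V)"
  shows "prob_space.entropy S b (count_space (fst ` space S)) fst = log b (real (card M))"
proof -
  have fin: "finite (M \<times> V)" "M \<times> V \<noteq> {}" using assms by auto
  interpret information_space S b unfolding S_def by (rule information_space_uniform_count_measure[OF fin assms(5)])
  have sp: "space S = M \<times> V" "fst ` space S = M" using assms by (auto simp: space_uniform_count_measure)
  have sd: "simple_distributed S fst (\<lambda>x. measure S (fst -` {x} \<inter> space S))"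
    by (rule simple_distributedI) (auto simp: S_def intro: simple_function_uniform_count_measure fin)
  have pr: "measure S (fst -` {x} \<inter> space S) = 1 / card M" if "x \<in> M" for x
  proof -
    have "fst -` {x} \<inter> space S = {x} \<times> V" using that sp by auto
    moreover have "{x} \<times> V \<subseteq> M \<times> V" using that by auto
    ultimately show ?thesis using assms fin
      by (simp add: S_def measure_uniform_count_measure card_cartesian_product)
  qed
  have "entropy b (count_space (fst ` space S)) fst
     = - (\<Sum>x\<in>fst ` space S. measure S (fst -` {x} \<inter> space S) * log b (measure S (fst -` {x} \<inter> space S)))"
    by (rule entropy_simple_distributed[OF sd])
  also have "\<dots> = - (\<Sum>x\<in>M. 1 / card M * log b (1 / card M))"
    unfolding sp(2) by (simp add: pr)
  also have "\<dots> = log b (card M)"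
    using assms by (simp add: log_divide)
  finally show ?thesis .
qed

text \<open>The inequality is used in both directions, so the conditional law of \<open>Y\<close> is
  the same for every message and the joint law is the product of the marginals. In this form an
  injection between fibres is enough to supply it.\<close>

lemma mutual_information_fst_eq_0:
  fixes V :: "'b set" and Y :: "'a \<times> 'b \<Rightarrow> 'c"
  assumes "finite M" "finite V" "M \<noteq> {}" "V \<noteq> {}" "1 < b"
    and same: "\<And>m m' y. m \<in> M \<Longrightarrow> m' \<in> M \<Longrightarrow> card {r \<in> V. Y (m, r) = y} \<le> card {r \<in> V. Y (m', r) = y}"
  defines "S \<equiv> uniform_count_measure (M \<times> V)"
  shows "prob_space.mutual_information S b (count_space (fst ` space S)) (count_space (Y ` space S)) fst Y = 0"
proof -
  have fin: "finite (M \<times> V)" "M \<times> V \<noteq> {}" using assms by auto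
  interpret information_space S b unfolding S_def by (rule information_space_uniform_count_measure[OF fin assms(5)])
  have sp: "space S = M \<times> V" "fst ` space S = M" using assms by (auto simp: space_uniform_count_measure)
  have sd: "simple_distributed S Z (\<lambda>x. measure S (Z -` {x} \<inter> space S))" for Z :: "'a \<times> 'b \<Rightarrow> 'd"
    by (rule simple_distributedI) (auto simp: S_def intro: simple_function_uniform_count_measure fin)
  have meas: "measure S E = card E / (card M * card V)" if "E \<subseteq> M \<times> V" for E
    using fin that by (simp add: S_def measure_uniform_count_measure card_cartesian_product)
  have pos: "card M > 0" "card V > 0" using assms by (auto simp: card_gt_0_iff)
  obtain m0 where m0: "m0 \<in> M" using assms by auto
  define n where "n y = card {r \<in> V. Y (m0, r) = y}" for y
  have n: "card {r \<in> V. Y (m, r) = y} = n y" if "m \<in> M" for m y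
    using same[OF that m0] same[OF m0 that] unfolding n_def by (meson order_antisym)
  have pX: "measure S (fst -` {x} \<inter> space S) = 1 / card M" if "x \<in> M" for x
  proof -
    have "fst -` {x} \<inter> space S = {x} \<times> V" using that sp by auto
    moreover have "{x} \<times> V \<subseteq> M \<times> V" using that by auto
    ultimately show ?thesis using pos by (simp add: meas card_cartesian_product)
  qed
  have pY: "measure S (Y -` {y} \<inter> space S) = n y / card V" for y
  proof -
    have "Y -` {y} \<inter> space S = (SIGMA m:M. {r \<in> V. Y (m, r) = y})" using sp by auto
    moreover have "card (SIGMA m:M. {r \<in> V. Y (m, r) = y}) = card M * n y"
      using assms by (subst card_SigmaI) (auto simp: n)
    ultimately show ?thesis using pos by (simp add: meas sp subset_iff)
  qed
  have pXY: "measure S ((\<lambda>x. (fst x, Y x)) -` {(x, y)} \<inter> space S) = n y / (card M * card V)" if "x \<in> M" for x y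
  proof -
    have "(\<lambda>x. (fst x, Y x)) -` {(x, y)} \<inter> space S = {x} \<times> {r \<in> V. Y (x, r) = y}" using sp that by auto
    then show ?thesis using pos that by (auto simp: meas card_cartesian_product n subset_iff)
  qed
  show ?thesis
    unfolding mutual_information_simple_distributed[OF sd sd sd]
  proof (intro sum.neutral ballI)
    fix xy assume "xy \<in> (\<lambda>x. (fst x, Y x)) ` space S"
    then obtain x y where xy: "xy = (x, y)" "x \<in> M" by (auto simp: sp)
    have "measure S ((\<lambda>x. (fst x, Y x)) -` {(x, y)} \<inter> space S) = 0 \<or>
       measure S ((\<lambda>x. (fst x, Y x)) -` {(x, y)} \<inter> space S) / (measure S (fst -` {x} \<inter> space S) * measure S (Y -` {y} \<inter> space S)) = 1"
      unfolding pX[OF xy(2)] pY pXY[OF xy(2)] using pos by auto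
    then show "(case xy of (x, y) \<Rightarrow> measure S ((\<lambda>x. (fst x, Y x)) -` {(x, y)} \<inter> space S) *
        log b (measure S ((\<lambda>x. (fst x, Y x)) -` {(x, y)} \<inter> space S) / (measure S (fst -` {x} \<inter> space S) * measure S (Y -` {y} \<inter> space S)))) = 0"
      unfolding xy(1) prod.case by (elim disjE) (simp_all del: divide_eq_1_iff)
  qed
qed


section \<open>The packet code\<close>

text \<open>Address of a random symbol of the source. The first argument tells its role: 0 for coefficients of the
  shares, 1 for hash keys, 2 for masks, 3 for the keys of the manipulation detection code.\<close>
definition idx :: "nat \<Rightarrow> nat \<Rightarrow> nat \<Rightarrow> nat" where
  "idx t i j = prod_encode (t, prod_encode (i, j))"

lemma idx_eq_iff [simp]: "idx t i j = idx t' i' j' \<longleftrightarrow> t = t' \<and> i = i' \<and> j = j'"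
  by (simp add: idx_def prod_encode_eq)

section \<open>Collision counts for the hash and the manipulation detection code\<close>

definition poly_hash :: "nat \<Rightarrow> int \<Rightarrow> symbols \<Rightarrow> int" where
  "poly_hash n a x = (\<Sum>k<n. x k * a ^ Suc k)"

lemma poly_hash_cong: "(\<And>k. k < n \<Longrightarrow> x k = y k) \<Longrightarrow> poly_hash n a x = poly_hash n a y"
  by (simp add: poly_hash_def)

lemma poly_hash_mod_cong: "[a = b] (mod p) \<Longrightarrow> [poly_hash n a x = poly_hash n b x] (mod p)"
  unfolding poly_hash_def by (intro cong_sum cong_mult cong_pow) auto

text \<open>Keys are later varied by translation. Translations permute the residues, so a count over
  keys carries over to a count over translations.\<close>

lemma card_shifted_roots_le:
  fixes p :: int
  assumes "0 < p" "card {x \<in> {0..<p}. P x} \<le> k"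
  shows "card {x \<in> {0..<p}. P ((a + x) mod p)} \<le> k"
proof -
  have "inj_on (\<lambda>x. (a + x) mod p) {0..<p}"
  proof (rule inj_onI)
    fix x y assume "x \<in> {0..<p}" "y \<in> {0..<p}" "(a + x) mod p = (a + y) mod p"
    then have "[x = y] (mod p)" by (simp add: cong_add_lcancel flip: cong_def)
    then show "x = y" using \<open>x \<in> _\<close> \<open>y \<in> _\<close> by (simp add: cong_def)
  qed
  then have "card {x \<in> {0..<p}. P ((a + x) mod p)} = card ((\<lambda>x. (a + x) mod p) ` {x \<in> {0..<p}. P ((a + x) mod p)})"
    by (intro card_image[symmetric]) (elim inj_on_subset, blast)
  also have "\<dots> \<le> card {x \<in> {0..<p}. P x}"
    using assms(1) by (intro card_mono) (auto intro: finite_subset[of _ "{0..<p}"])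
  finally show ?thesis using assms(2) by simp
qed

text \<open>The hash has no constant term: the offset \<open>e\<close>, which absorbs masks and
  forged tags, occupies degree 0 alone, and a change at position \<open>l\<close> stays visible in
  degree \<open>l + 1\<close>.\<close>

lemma card_hash_collisions_le:
  fixes p :: int
  assumes p: "prime p" and l: "l < n" "\<not> [y l = x l] (mod p)"
  shows "card {a \<in> {0..<p}. [poly_hash n a y = poly_hash n a x + e] (mod p)} \<le> n"
proof -
  define c where "c k = (if k = 0 then - e else y (k - 1) - x (k - 1))" for k
  have ev: "(\<Sum>k\<le>n. c k * a ^ k) = poly_hash n a y - (poly_hash n a x + e)" for a
    by (simp add: c_def poly_hash_def sum.atMost_shift sum_subtractf algebra_simps)
  have "card {a \<in> {0..<p}. p dvd (\<Sum>k\<le>n. c k * a ^ k)} \<le> n"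
    by (rule card_sum_roots_mod_prime[OF p, of "Suc l"]) (use l in \<open>auto simp: c_def cong_iff_dvd_diff\<close>)
  then show ?thesis by (simp add: ev cong_iff_dvd_diff)
qed

text \<open>The leading power makes every additive change of the key visible: it contributes
  \<open>(n + 2) \<delta>\<close> to the coefficient of degree \<open>n + 1\<close>, which no change of the body can cancel.\<close>
lemma card_amd_forgeries_le:
  fixes p :: int
  assumes p: "prime p" and n: "int n + 2 < p"
    and l: "l < n" "\<not> [y l = x l] (mod p)"
  shows "card {c \<in> {0..<p}. [(c + \<delta>) ^ (n + 2) + poly_hash n (c + \<delta>) y = c ^ (n + 2) + poly_hash n c x + e] (mod p)} \<le> n + 2"
\<comment> \<open>A key unchanged modulo \<open>p\<close> makes the leading powers cancel and leaves
  an ordinary hash collision.\<close>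
proof (cases "p dvd \<delta>")
  case True
  have "[(c + \<delta>) ^ (n + 2) + poly_hash n (c + \<delta>) y = c ^ (n + 2) + poly_hash n c y] (mod p)" for c
    using True by (intro cong_add cong_pow poly_hash_mod_cong) (auto simp: cong_iff_dvd_diff)
  then have "{c \<in> {0..<p}. [(c + \<delta>) ^ (n + 2) + poly_hash n (c + \<delta>) y = c ^ (n + 2) + poly_hash n c x + e] (mod p)}
     \<subseteq> {c \<in> {0..<p}. [poly_hash n c y = poly_hash n c x + e] (mod p)}"
    by (auto simp: add.assoc cong_add_lcancel) (metis cong_add_lcancel cong_sym cong_trans)
  then have "card {c \<in> {0..<p}. [(c + \<delta>) ^ (n + 2) + poly_hash n (c + \<delta>) y = c ^ (n + 2) + poly_hash n c x + e] (mod p)}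
     \<le> card {c \<in> {0..<p}. [poly_hash n c y = poly_hash n c x + e] (mod p)}"
    by (intro card_mono) (auto intro: finite_subset[of _ "{0..<p}"])
  then show ?thesis using card_hash_collisions_le[where x = x and y = y, OF p l, of e] by simp
next
  case False
  define Q :: "int poly" where
    "Q = [:\<delta>, 1:] ^ (n + 2) - Polynomial.monom 1 (n + 2)
       + (\<Sum>k<n. Polynomial.smult (y k) ([:\<delta>, 1:] ^ Suc k) - Polynomial.monom (x k) (Suc k)) - [:e:]"
  have ev: "poly Q c = ((c + \<delta>) ^ (n + 2) + poly_hash n (c + \<delta>) y) - (c ^ (n + 2) + poly_hash n c x + e)" for c
    by (simp add: Q_def poly_sum poly_monom poly_hash_def sum_subtractf algebra_simps)
  have deg: "degree Q \<le> n + 2"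
    unfolding Q_def
    by (intro degree_diff_le degree_add_le degree_sum_le)
       (auto simp: degree_linear_power intro!: degree_diff_le intro: order_trans[OF degree_monom_le] order_trans[OF degree_smult_le]
          simp del: power_Suc)
  have "Polynomial.coeff ([:\<delta>, 1:] ^ Suc k) (Suc n) = 0" if "k < n" for k
    using that by (intro coeff_eq_0) (simp add: degree_linear_power del: power_Suc)
  then have "Polynomial.coeff (\<Sum>k<n. Polynomial.smult (y k) ([:\<delta>, 1:] ^ Suc k) - Polynomial.monom (x k) (Suc k)) (Suc n) = 0"
    by (simp add: coeff_sum del: power_Suc)
  moreover have "Polynomial.coeff ([:\<delta>, 1:] ^ (n + 2)) (Suc n) = (int n + 2) * \<delta>"
    by (subst coeff_linear_poly_power) (auto simp: simp del: power_Suc)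
  ultimately have "Polynomial.coeff Q (Suc n) = (int n + 2) * \<delta>"
    by (simp add: Q_def del: power_Suc)
  \<comment> \<open>Here the size of the field matters: the coefficient
    \<open>(int n + 2) * \<delta>\<close> survives modulo \<open>p\<close>.\<close>
  moreover have "\<not> p dvd int n + 2" using n zdvd_not_zless[of "int n + 2" p] by simp
  ultimately have "\<not> p dvd Polynomial.coeff Q (Suc n)"
    using False p by (simp add: prime_dvd_mult_iff)
  then have "\<not> [:p:] dvd Q" unfolding const_poly_dvd_iff by metis
  from card_roots_mod_prime[OF p this] show ?thesis
    using deg unfolding ev cong_iff_dvd_diff by simp
qed

section \<open>Packets, consistency checks and the decoder\<close>

locale coset_code =
  fixes p :: int and d L z R rlen M :: nat and h :: "nat \<Rightarrow> nat \<times> nat \<Rightarrow> int"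
  assumes prime: "prime p" and large: "int (L + 2 * d + 2) < p"
    and idx_less: "\<And>t i j. t < 4 \<Longrightarrow> i < L + d \<Longrightarrow> j < z + d + 1 \<Longrightarrow> idx t i j < rlen"
    and h: "bij_betw h {..<M} (({..<L} \<times> {..<R}) \<rightarrow>\<^sub>E {0..<p})"
begin

text \<open>Layout of a packet: \<open>L\<close> share symbols, \<open>d\<close> keys,
  \<open>d\<close> masks, \<open>d\<close> tags, then the manipulation detection key and its check
  symbol.\<close>

abbreviation "N \<equiv> L + 3 * d + 2"
abbreviation "V \<equiv> {..<rlen} \<rightarrow>\<^sub>E {0..<p}"
abbreviation "\<Omega> \<equiv> {..<M} \<times> V"

lemma p_pos: "0 < p" using prime prime_gt_0_int by blast

lemma finite_V: "finite V" by (intro finite_PiE) auto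

text \<open>The random coefficients take the low degrees, so that they range over all polynomials of
  degree below \<open>z\<close>, which attain arbitrary values at any \<open>z\<close> points,
  including the point 0 of path 0.\<close>

definition coef :: "nat \<times> symbols \<Rightarrow> nat \<Rightarrow> nat \<Rightarrow> int" where
  "coef \<omega> l k = (if k < z then snd \<omega> (idx 0 l k) else h (fst \<omega>) (l, k - z))"

definition share :: "nat \<times> symbols \<Rightarrow> nat \<Rightarrow> nat \<Rightarrow> int" where
  "share \<omega> i l = (\<Sum>k<z + R. coef \<omega> l k * int i ^ k) mod p"

text \<open>Key and mask belong to packet \<open>j\<close>, the first index of \<open>idx\<close>
  being the owner, whereas the tag travels in packet \<open>i\<close>. The mask keeps the tag from
  revealing the key.\<close>

definition tag :: "nat \<times> symbols \<Rightarrow> nat \<Rightarrow> nat \<Rightarrow> int" where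
  "tag \<omega> i j = (poly_hash L (snd \<omega> (idx 1 j i)) (share \<omega> i) + snd \<omega> (idx 2 j i)) mod p"

text \<open>The part guarded by the check symbol. Tags are left out: a packet is trusted for its
  share, keys and masks, not for the tags by which others judge it.\<close>

definition body :: "nat \<times> symbols \<Rightarrow> nat \<Rightarrow> symbols" where
  "body \<omega> i n =
     (if n < L then share \<omega> i n
      else if n < L + d then snd \<omega> (idx 1 i (n - L))
      else snd \<omega> (idx 2 i (n - L - d)))"

definition packet :: "nat \<times> symbols \<Rightarrow> nat \<Rightarrow> symbols" where
  "packet \<omega> i = (\<lambda>n\<in>{..<N}.
     if n < L + 2 * d then body \<omega> i n
     else if n < L + 3 * d then tag \<omega> i (n - L - 2 * d)
     else if n = L + 3 * d then snd \<omega> (idx 3 i 0)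
     else (snd \<omega> (idx 3 i 0) ^ (L + 2 * d + 2) + poly_hash (L + 2 * d) (snd \<omega> (idx 3 i 0)) (body \<omega> i)) mod p)"

definition self_ok :: "symbols \<Rightarrow> bool" where
  "self_ok x \<longleftrightarrow> [x (L + 3 * d) ^ (L + 2 * d + 2) + poly_hash (L + 2 * d) (x (L + 3 * d)) x = x (L + 3 * d + 1)] (mod p)"

definition vouches :: "nat \<Rightarrow> symbols \<Rightarrow> nat \<Rightarrow> symbols \<Rightarrow> bool" where
  "vouches j x i y \<longleftrightarrow> [poly_hash L (x (L + i)) y + x (L + d + i) = y (L + 2 * d + j)] (mod p)"

text \<open>Each row has \<open>z + R\<close> coefficients, so that many shares determine the
  message. \<open>S\<close> may contain altered packets; only the checks and agreement with some
  encoding of \<open>m\<close> are tested.\<close>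

definition plausible :: "(nat \<Rightarrow> symbols) \<Rightarrow> nat \<Rightarrow> bool" where
  "plausible y m \<longleftrightarrow> m < M \<and> (\<exists>S\<subseteq>{..<d}. z + R \<le> card S \<and> (\<forall>i\<in>S. self_ok (y i)) \<and>
     (\<forall>i\<in>S. \<forall>j\<in>S. i \<noteq> j \<longrightarrow> vouches j (y j) i (y i)) \<and>
     (\<exists>r\<in>V. \<forall>i\<in>S. \<forall>l<L. y i l = share (m, r) i l))"

definition dec :: "(nat \<Rightarrow> symbols) \<Rightarrow> nat" where
  "dec y = (if \<exists>m. plausible y m then SOME m. plausible y m else 0)"

lemma share_range: "share \<omega> i l \<in> {0..<p}"
  using p_pos by (simp add: share_def)

lemma packet_share: "l < L \<Longrightarrow> packet \<omega> i l = share \<omega> i l"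
  by (simp add: packet_def body_def)

lemma packet_body: "n < L + 2 * d \<Longrightarrow> packet \<omega> i n = body \<omega> i n"
  by (simp add: packet_def)

lemma packet_key_a: "j < d \<Longrightarrow> packet \<omega> i (L + j) = snd \<omega> (idx 1 i j)"
  by (simp add: packet_def body_def)

lemma packet_key_b: "j < d \<Longrightarrow> packet \<omega> i (L + d + j) = snd \<omega> (idx 2 i j)"
  by (simp add: packet_def body_def)

lemma packet_tag: "j < d \<Longrightarrow> packet \<omega> i (L + 2 * d + j) = tag \<omega> i j"
  by (simp add: packet_def)

lemma packet_self: "packet \<omega> i (L + 3 * d) = snd \<omega> (idx 3 i 0)"
  by (simp add: packet_def)

lemma packet_check: "packet \<omega> i (L + 3 * d + 1) =
    (snd \<omega> (idx 3 i 0) ^ (L + 2 * d + 2) + poly_hash (L + 2 * d) (snd \<omega> (idx 3 i 0)) (body \<omega> i)) mod p"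
  by (simp add: packet_def)

lemma self_ok_packet: "self_ok (packet \<omega> i)"
proof -
  have "poly_hash (L + 2 * d) a (packet \<omega> i) = poly_hash (L + 2 * d) a (body \<omega> i)" for a
    by (rule poly_hash_cong) (simp add: packet_body)
  then show ?thesis unfolding self_ok_def packet_self packet_check by (simp add: cong_def)
qed

lemma vouches_packet: "i < d \<Longrightarrow> j < d \<Longrightarrow> vouches j (packet \<omega> j) i (packet \<omega> i)"
proof -
  assume "i < d" "j < d"
  moreover have "poly_hash L a (packet \<omega> i) = poly_hash L a (share \<omega> i)" for a
    by (rule poly_hash_cong) (simp add: packet_share)
  ultimately show ?thesis
    unfolding vouches_def by (simp add: packet_key_a packet_key_b packet_tag tag_def)
qed

lemma packet_in_vecs:
  assumes "\<omega> \<in> \<Omega>" "i < d"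
  shows "packet \<omega> i \<in> {..<N} \<rightarrow>\<^sub>E {0..<p}"
proof
  fix n assume n: "n \<in> {..<N}"
  have r: "snd \<omega> (idx t i j) \<in> {0..<p}" if "t < 4" "j < d + 1" for t j
  proof (rule PiE_mem[of "snd \<omega>" "{..<rlen}" "\<lambda>_. {0..<p}"])
    show "snd \<omega> \<in> V" using assms(1) by (simp only: mem_Times_iff)
    show "idx t i j \<in> {..<rlen}" using assms(2) idx_less[of t i j] that by simp
  qed
  have "n < L \<or> L \<le> n \<and> n < L + d \<or> L + d \<le> n \<and> n < L + 2 * d \<or> \<not> n < L + 2 * d" by linarith
  then show "packet \<omega> i n \<in> {0..<p}"
    using n share_range[of \<omega> i n] r[of 1 "n - L"] r[of 2 "n - L - d"] r[of 3 0] p_pos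
    by (auto simp: packet_def body_def tag_def)
qed (simp add: packet_def)

text \<open>In each row the difference of the two polynomials has degree below \<open>z + R\<close>
  and vanishes at the points of \<open>S\<close>, which are distinct residues since
  \<open>d < p\<close>. All coefficients thus agree modulo \<open>p\<close>, and \<open>h\<close>
  recovers the message from them.\<close>

lemma plausible_imp_eq:
  assumes S: "S \<subseteq> {..<d}" "z + R \<le> card S" and "\<omega> \<in> \<Omega>" "\<omega>' \<in> \<Omega>"
    and eq: "\<And>i l. i \<in> S \<Longrightarrow> l < L \<Longrightarrow> share \<omega> i l = share \<omega>' i l"
  shows "fst \<omega> = fst \<omega>'"
proof -
  have "[coef \<omega> l k = coef \<omega>' l k] (mod p)" if l: "l < L" and k: "k < z + R" for l k
  proof (rule ccontr)
    assume neq: "\<not> ?thesis"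
    have "card {x \<in> {0..<p}. p dvd (\<Sum>k\<le>z + R - 1. (coef \<omega> l k - coef \<omega>' l k) * x ^ k)} \<le> z + R - 1"
      by (rule card_sum_roots_mod_prime[OF prime, of k]) (use neq k in \<open>auto simp: cong_iff_dvd_diff\<close>)
    moreover have "int ` S \<subseteq> {x \<in> {0..<p}. p dvd (\<Sum>k\<le>z + R - 1. (coef \<omega> l k - coef \<omega>' l k) * x ^ k)}"
    proof
      fix x assume "x \<in> int ` S"
      then obtain i where i: "i \<in> S" "x = int i" by auto
      have "{..z + R - 1} = {..<z + R}" using k by auto
      moreover have "p dvd (\<Sum>k<z + R. coef \<omega> l k * int i ^ k) - (\<Sum>k<z + R. coef \<omega>' l k * int i ^ k)"
        using eq[OF i(1) l] by (simp add: share_def mod_eq_dvd_iff)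
      moreover have "i < d" using S i by auto
      ultimately show "x \<in> {x \<in> {0..<p}. p dvd (\<Sum>k\<le>z + R - 1. (coef \<omega> l k - coef \<omega>' l k) * x ^ k)}"
        using i large by (simp add: left_diff_distrib sum_subtractf)
    qed
    then have "card (int ` S) \<le> card {x \<in> {0..<p}. p dvd (\<Sum>k\<le>z + R - 1. (coef \<omega> l k - coef \<omega>' l k) * x ^ k)}"
      by (intro card_mono) (auto intro: finite_subset[of _ "{0..<p}"])
    moreover have "card (int ` S) = card S" by (simp add: card_image)
    ultimately show False using S k by linarith
  qed
  note * = this
  have mem: "h (fst \<omega>) \<in> ({..<L} \<times> {..<R}) \<rightarrow>\<^sub>E {0..<p}" "h (fst \<omega>') \<in> ({..<L} \<times> {..<R}) \<rightarrow>\<^sub>E {0..<p}"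
    using assms(3,4) bij_betwE[OF h] by (simp_all only: mem_Times_iff)
  have "h (fst \<omega>) = h (fst \<omega>')"
  proof (rule PiE_ext[OF mem])
    fix q assume "q \<in> {..<L} \<times> {..<R}"
    then obtain l k where q: "q = (l, k)" "l < L" "k < R" by auto
    have "[h (fst \<omega>) (l, k) = h (fst \<omega>') (l, k)] (mod p)"
      using *[of l "z + k"] q by (simp add: coef_def)
    moreover have "h (fst \<omega>) (l, k) \<in> {0..<p}" "h (fst \<omega>') (l, k) \<in> {0..<p}"
      using mem q by (auto simp: PiE_iff)
    ultimately show "h (fst \<omega>) q = h (fst \<omega>') q" by (simp add: cong_def q)
  qed
  then show ?thesis using assms(3,4) bij_betw_imp_inj_on[OF h] by (simp only: mem_Times_iff inj_on_eq_iff)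
qed

text \<open>The routed decoder supplies a function on all naturals whose values from
  \<open>d\<close> on carry no meaning.\<close>

lemma dec_cong:
  assumes "\<And>i. i < d \<Longrightarrow> y i = y' i"
  shows "dec y = dec y'"
proof -
  have "plausible y m \<longleftrightarrow> plausible y' m" for m
  proof -
    have "(self_ok (y i) \<longleftrightarrow> self_ok (y' i)) \<and> y i = y' i" if "i \<in> S" "S \<subseteq> {..<d}" for i S
      using assms that by auto
    then show ?thesis unfolding plausible_def
      by (intro conj_cong refl ex_cong1 ball_cong) (auto simp: subset_iff)
  qed
  then have "plausible y = plausible y'" by (rule ext)
  then show ?thesis by (simp add: dec_def)
qed

lemma dec_in_msgs: "dec y \<in> {..<M}"
proof -
  have "0 < M"
  proof -
    have "(\<lambda>_\<in>{..<L} \<times> {..<R}. 0) \<in> ({..<L} \<times> {..<R}) \<rightarrow>\<^sub>E {0..<p}" using p_pos by auto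
    then have "{..<M} \<noteq> {}" using bij_betw_imp_surj_on[OF h] by (metis empty_iff image_empty)
    then show ?thesis by auto
  qed
  moreover have "(SOME m. plausible y m) < M" if "\<exists>m. plausible y m"
    using someI_ex[OF that] by (simp only: plausible_def)
  ultimately show ?thesis by (simp add: dec_def)
qed

lemma packet_cong:
  assumes "\<And>l. l < L \<Longrightarrow> share \<omega> i l = share \<omega>' i l" "i < d"
    and "\<And>j. j < d \<Longrightarrow> tag \<omega> i j = tag \<omega>' i j"
    and "\<And>j. j < d \<Longrightarrow> snd \<omega> (idx 1 i j) = snd \<omega>' (idx 1 i j)"
    and "\<And>j. j < d \<Longrightarrow> snd \<omega> (idx 2 i j) = snd \<omega>' (idx 2 i j)"
    and "snd \<omega> (idx 3 i 0) = snd \<omega>' (idx 3 i 0)"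
  shows "packet \<omega> i = packet \<omega>' i"
proof -
  have b: "body \<omega> i n = body \<omega>' i n" if "n < L + 2 * d" for n
    using assms that by (auto simp: body_def)
  show ?thesis unfolding packet_def
    by (intro restrict_ext) (use assms in \<open>auto simp: b intro!: arg_cong[of _ _ "\<lambda>x. x mod p"] arg_cong2[of _ _ _ _ "(+)"] poly_hash_cong\<close>)
qed

lemma share_cong:
  assumes "fst \<omega> = fst \<omega>'" "\<And>k. k < z \<Longrightarrow> snd \<omega> (idx 0 l k) = snd \<omega>' (idx 0 l k)"
  shows "share \<omega> i l = share \<omega>' i l"
  unfolding share_def coef_def using assms by (intro arg_cong[of _ _ "\<lambda>x. x mod p"] sum.cong) auto

lemma tag_cong:
  assumes "\<And>l. l < L \<Longrightarrow> share \<omega> i l = share \<omega>' i l"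
    and "snd \<omega> (idx 1 j i) = snd \<omega>' (idx 1 j i)" "snd \<omega> (idx 2 j i) = snd \<omega>' (idx 2 j i)"
  shows "tag \<omega> i j = tag \<omega>' i j"
  unfolding tag_def using assms
  by (auto intro!: arg_cong[of _ _ "\<lambda>x. x mod p"] arg_cong2[of _ _ _ _ "(+)"] poly_hash_cong)

section \<open>Secrecy by translating the random symbols\<close>

definition shift :: "(nat \<Rightarrow> int) \<Rightarrow> symbols \<Rightarrow> symbols" where
  "shift s r = (\<lambda>n\<in>{..<rlen}. (r n + s n) mod p)"

lemma shift_in: "shift s r \<in> V"
  using p_pos by (auto simp: shift_def)

lemma inj_on_shift: "inj_on (shift s) V"
proof (rule inj_onI)
  fix r r' assume r: "r \<in> V" "r' \<in> V" "shift s r = shift s r'"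
  show "r = r'"
  proof (rule PiE_ext[OF r(1,2)])
    fix n assume n: "n \<in> {..<rlen}"
    then have "(r n + s n) mod p = (r' n + s n) mod p" using fun_cong[OF r(3), of n] by (simp add: shift_def)
    then have "[r n = r' n] (mod p)" by (simp add: cong_add_rcancel flip: cong_def)
    moreover have "r n \<in> {0..<p}" "r' n \<in> {0..<p}" using r n by (auto simp: PiE_iff)
    ultimately show "r n = r' n" by (simp add: cong_def)
  qed
qed

lemma shift_nth: "n < rlen \<Longrightarrow> shift s r n = (r n + s n) mod p"
  by (simp add: shift_def)

lemma shift_nth_0: "r \<in> V \<Longrightarrow> n < rlen \<Longrightarrow> s n = 0 \<Longrightarrow> shift s r n = r n"
  by (auto simp: shift_def PiE_iff)

text \<open>Shifting the random coefficients by the polynomial of degree below \<open>z\<close> that interpolates the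
  difference of the message parts at the observed points keeps all observed packets.\<close>
lemma secrecy_shift:
  assumes A: "A \<subseteq> {..<d}" "card A \<le> z" and m: "m < M" "m' < M"
  shows "\<exists>s. \<forall>r\<in>V. \<forall>i\<in>A. packet (m, r) i = packet (m', shift s r) i"
proof -
  define v where "v l x = (\<Sum>k<R. (h m (l, k) - h m' (l, k)) * x ^ (z + k))" for l and x :: int
  have "\<exists>c. \<forall>i\<in>A. [(\<Sum>k<z. c k * int i ^ k) = v l (int i)] (mod p)" for l
  proof -
    have fA: "finite A" using A finite_subset by blast
    then have "\<exists>Q :: int poly. (Q = 0 \<or> degree Q < card (int ` A)) \<and> (\<forall>x\<in>int ` A. [poly Q x = v l x] (mod p))"
      using A(1) large by (intro interpolation_mod_prime[OF prime]) auto
    then obtain Q :: "int poly" where Q: "Q = 0 \<or> degree Q < card A" "\<forall>i\<in>A. [poly Q (int i) = v l (int i)] (mod p)"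
      by (auto simp: card_image)
    have "Q = 0 \<or> degree Q < z" using Q(1) A(2) by auto
    from poly_eq_sum_lessThan[OF this] show ?thesis using Q(2) by metis
  qed
  then obtain c where c: "\<And>l i. i \<in> A \<Longrightarrow> [(\<Sum>k<z. c l k * int i ^ k) = v l (int i)] (mod p)" by metis
  \<comment> \<open>Only addresses of role 0 are translated. Keys and masks stay fixed, and the tags
    in observed packets then agree because the shares do.\<close>
  define s where "s n = (case prod_decode n of (t, q) \<Rightarrow> case prod_decode q of (l, k) \<Rightarrow> if t = 0 then c l k else 0)" for n
  have s: "s (idx t l k) = (if t = 0 then c l k else 0)" for t l k
    by (simp add: s_def idx_def)
  show ?thesis
  proof (intro exI[of _ s] ballI)
    fix r i assume r: "r \<in> V" and i: "i \<in> A"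
    then have id: "i < d" using A by auto
    have sh: "share (m, r) i l = share (m', shift s r) i l" if l: "l < L" for l
    proof -
      have split: "(\<Sum>k<z + R. f k) = (\<Sum>k<z. f k) + (\<Sum>k<R. f (z + k))" for f :: "nat \<Rightarrow> int"
        by (induction R) (auto simp: algebra_simps)
      have "[(\<Sum>k<z. shift s r (idx 0 l k) * int i ^ k) = (\<Sum>k<z. (r (idx 0 l k) + c l k) * int i ^ k)] (mod p)"
        using l by (intro cong_sum cong_mult) (auto simp: shift_nth idx_less s cong_def)
      also have "(\<Sum>k<z. (r (idx 0 l k) + c l k) * int i ^ k) = (\<Sum>k<z. r (idx 0 l k) * int i ^ k) + (\<Sum>k<z. c l k * int i ^ k)"
        by (simp add: distrib_right sum.distrib)
      also have "[\<dots> = (\<Sum>k<z. r (idx 0 l k) * int i ^ k) + v l (int i)] (mod p)"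
        using c[OF i] by (simp add: cong_add_lcancel)
      finally have "[(\<Sum>k<z. shift s r (idx 0 l k) * int i ^ k) + (\<Sum>k<R. h m' (l, k) * int i ^ (z + k))
          = (\<Sum>k<z. r (idx 0 l k) * int i ^ k) + v l (int i) + (\<Sum>k<R. h m' (l, k) * int i ^ (z + k))] (mod p)"
        by (simp add: cong_add_rcancel)
      also have "(\<Sum>k<z. r (idx 0 l k) * int i ^ k) + v l (int i) + (\<Sum>k<R. h m' (l, k) * int i ^ (z + k))
          = (\<Sum>k<z. r (idx 0 l k) * int i ^ k) + (\<Sum>k<R. h m (l, k) * int i ^ (z + k))"
        by (simp add: v_def left_diff_distrib sum_subtractf)
      finally show ?thesis unfolding share_def coef_def split by (simp add: cong_def)
    qed
    have keys: "shift s r (idx t i' j') = r (idx t i' j')" if "0 < t" "t < 4" "i' < d" "j' < d + 1" for t i' j'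
      using that r by (intro shift_nth_0) (auto simp: s idx_less)
    show "packet (m, r) i = packet (m', shift s r) i"
      by (rule packet_cong) (use sh id keys in \<open>auto intro!: tag_cong\<close>)
  qed
qed

text \<open>\<open>obs\<close> is any quantity determined by the packets in \<open>A\<close>; later
  it is the whole observation, including effects of the adversary's own injections. The translation
  maps the randomness behind an observation under \<open>m\<close> injectively into that under
  \<open>m'\<close>.\<close>

lemma secrecy:
  fixes obs :: "nat \<times> symbols \<Rightarrow> 'o"
  assumes A: "A \<subseteq> {..<d}" "card A \<le> z" and m: "m < M" "m' < M"
    and obs: "\<And>\<omega> \<omega>'. \<omega> \<in> \<Omega> \<Longrightarrow> \<omega>' \<in> \<Omega> \<Longrightarrow> (\<And>i. i \<in> A \<Longrightarrow> packet \<omega> i = packet \<omega>' i) \<Longrightarrow> obs \<omega> = obs \<omega>'"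
  shows "card {r \<in> V. obs (m, r) = y} \<le> card {r \<in> V. obs (m', r) = y}"
proof -
  obtain s where s: "\<And>r i. r \<in> V \<Longrightarrow> i \<in> A \<Longrightarrow> packet (m, r) i = packet (m', shift s r) i"
    using secrecy_shift[OF A m] by blast
  have eq: "obs (m, r) = obs (m', shift s r)" if "r \<in> V" for r
    using that m shift_in by (intro obs s) auto
  show ?thesis
  proof (rule card_inj_on_le[of "shift s"])
    show "inj_on (shift s) {r \<in> V. obs (m, r) = y}" using inj_on_shift by (rule inj_on_subset) auto
    show "shift s ` {r \<in> V. obs (m, r) = y} \<subseteq> {r \<in> V. obs (m', r) = y}" using eq shift_in by auto
    show "finite {r \<in> V. obs (m', r) = y}" using finite_V by auto
  qed
qed

section \<open>Decoding when no forgery succeeds\<close>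

lemma plausible_true:
  assumes \<omega>: "\<omega> \<in> \<Omega>" and B: "B \<subseteq> {..<d}" "z + R + card B \<le> d"
    and y: "\<And>i. i < d \<Longrightarrow> i \<notin> B \<Longrightarrow> y i = packet \<omega> i"
  shows "plausible y (fst \<omega>)"
  unfolding plausible_def
proof (intro conjI exI[of _ "{..<d} - B"])
  have "card ({..<d} - B) = d - card B"
    using B(1) finite_subset by (subst card_Diff_subset) auto
  then show "z + R \<le> card ({..<d} - B)" using B by simp
  have "y i l = share (fst \<omega>, snd \<omega>) i l" if "i \<in> {..<d} - B" "l < L" for i l
    using that y by (simp add: packet_share)
  moreover have "snd \<omega> \<in> V" "fst \<omega> \<in> {..<M}" using \<omega> by (simp_all only: mem_Times_iff)
  ultimately show "\<exists>r\<in>V. \<forall>i\<in>{..<d} - B. \<forall>l<L. y i l = share (fst \<omega>, r) i l" "fst \<omega> < M" by blast+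
qed (use y self_ok_packet vouches_packet in auto)

text \<open>The deterministic half of the error analysis. By \<open>trusted\<close>, a set
  witnessing plausibility contains a packet \<open>j\<close> with genuine keys; by
  \<open>auth\<close>, its acceptance forces all others in the set to carry their true shares, and
  these determine the message.\<close>

lemma dec_eq:
  assumes \<omega>: "\<omega> \<in> \<Omega>" and B: "B \<subseteq> {..<d}" "z + R + card B \<le> d"
    and y: "\<And>i. i < d \<Longrightarrow> i \<notin> B \<Longrightarrow> y i = packet \<omega> i"
    and auth: "\<And>i j. i < d \<Longrightarrow> j < d \<Longrightarrow> j \<notin> A \<Longrightarrow> i \<noteq> j \<Longrightarrow> vouches j (packet \<omega> j) i (y i) \<Longrightarrow>
        \<forall>l<L. y i l = share \<omega> i l"
    and trusted: "\<And>S. S \<subseteq> {..<d} \<Longrightarrow> z + R \<le> card S \<Longrightarrow> \<forall>i\<in>S. self_ok (y i) \<Longrightarrow>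
        \<exists>j\<in>S. j \<notin> A \<and> (\<forall>n<L + 2 * d. y j n = packet \<omega> j n)"
  shows "dec y = fst \<omega>"
proof -
  have "m = fst \<omega>" if m: "plausible y m" for m
  proof -
    obtain S r where S: "S \<subseteq> {..<d}" "z + R \<le> card S" "\<forall>i\<in>S. self_ok (y i)"
      and v: "\<forall>i\<in>S. \<forall>j\<in>S. i \<noteq> j \<longrightarrow> vouches j (y j) i (y i)"
      and r: "r \<in> V" "\<forall>i\<in>S. \<forall>l<L. y i l = share (m, r) i l"
      using m unfolding plausible_def by blast
    from trusted[OF S] obtain j where j: "j \<in> S" "j \<notin> A" "\<forall>n<L + 2 * d. y j n = packet \<omega> j n" by blast
    have eq: "share \<omega> i l = share (m, r) i l" if i: "i \<in> S" and l: "l < L" for i l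
    proof (cases "i = j")
      case True
      then have "y i l = share \<omega> i l" using j l by (simp add: packet_share)
      then show ?thesis using r i l by simp
    next
      case False
      have d: "i < d" "j < d" using i j S by auto
      have "y j (L + i) = packet \<omega> j (L + i)" "y j (L + d + i) = packet \<omega> j (L + d + i)"
        using j(3) d by simp_all
      moreover have "vouches j (y j) i (y i)" using v i j(1) False by blast
      ultimately have "vouches j (packet \<omega> j) i (y i)" by (simp only: vouches_def)
      from auth[OF d j(2) False this] show ?thesis using r i l by simp
    qed
    have "(m, r) \<in> \<Omega>" using m r(1) by (simp add: plausible_def)
    from plausible_imp_eq[OF S(1,2) \<omega> this eq] show ?thesis by simp
  qed
  moreover have "plausible y (fst \<omega>)" by (rule plausible_true[OF \<omega> B y])
  ultimately show ?thesis unfolding dec_def by (metis someI)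
qed

end

section \<open>Error probability of decoding under attack\<close>

locale attacked_code = coset_code +
  fixes A B :: "nat set" and obs :: "nat \<times> symbols \<Rightarrow> 'o" and g :: "'o \<Rightarrow> nat \<Rightarrow> symbols \<Rightarrow> symbols"
  assumes B: "B \<subseteq> {..<d}" "z + R + card B \<le> d" and A: "A \<subseteq> {..<d}" "card A \<le> z" and R: "0 < R"
    and obs_cong: "\<And>\<omega> \<omega>'. \<omega> \<in> \<Omega> \<Longrightarrow> \<omega>' \<in> \<Omega> \<Longrightarrow> (\<And>i. i \<in> A \<Longrightarrow> packet \<omega> i = packet \<omega>' i) \<Longrightarrow> obs \<omega> = obs \<omega>'"
    and g_in: "\<And>\<omega> i x. \<omega> \<in> \<Omega> \<Longrightarrow> i < d \<Longrightarrow> x \<in> {..<N} \<rightarrow>\<^sub>E {0..<p} \<Longrightarrow> g (obs \<omega>) i x \<in> {..<N} \<rightarrow>\<^sub>E {0..<p}"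
    and g_unjammed: "\<And>\<omega> i x. i < d \<Longrightarrow> i \<notin> B \<Longrightarrow> g (obs \<omega>) i x = x"
begin

text \<open>Once the view \<open>obs \<omega>\<close> is fixed, the adversary acts on each path as a
  fixed map of that path's packet. Randomness not revealed by the view can be varied without
  changing these maps.\<close>

definition y :: "nat \<times> symbols \<Rightarrow> nat \<Rightarrow> symbols" where
  "y \<omega> i = g (obs \<omega>) i (packet \<omega> i)"

lemma y_in: "\<omega> \<in> \<Omega> \<Longrightarrow> i < d \<Longrightarrow> y \<omega> i \<in> {..<N} \<rightarrow>\<^sub>E {0..<p}"
  unfolding y_def by (intro g_in packet_in_vecs)

lemma range_eq_if_cong: "a \<in> {0..<p} \<Longrightarrow> b \<in> {0..<p} \<Longrightarrow> [a = b] (mod p) \<Longrightarrow> a = b"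
  by (simp add: cong_def)

lemma nth_range: "r \<in> V \<Longrightarrow> n < rlen \<Longrightarrow> r n \<in> {0..<p}"
  using PiE_mem[of r "{..<rlen}" "\<lambda>_. {0..<p}" n] by simp

lemma fun_upd_in: "r \<in> V \<Longrightarrow> n < rlen \<Longrightarrow> r(n := x mod p) \<in> V"
  using p_pos by (auto simp: PiE_iff extensional_def)

text \<open>The random shift of the key is compensated by the mask, so that the tag, and hence everything the
  adversary sees, does not change.\<close>
lemma forgery_bound:
  assumes ij: "i < d" "j < d" "i \<noteq> j" "j \<notin> A"
  shows "card {\<omega> \<in> \<Omega>. vouches j (packet \<omega> j) i (y \<omega> i) \<and> (\<exists>l<L. y \<omega> i l \<noteq> share \<omega> i l)} * nat p \<le> L * card \<Omega>"
proof -
  have lt: "idx 1 j i < rlen" "idx 2 j i < rlen" using ij by (auto intro!: idx_less)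
  define \<sigma> :: "int \<Rightarrow> nat \<times> symbols \<Rightarrow> nat \<times> symbols" where "\<sigma> x \<omega> = (fst \<omega>, (snd \<omega>)(idx 1 j i := (snd \<omega> (idx 1 j i) + x) mod p,
    idx 2 j i := (snd \<omega> (idx 2 j i) + poly_hash L (snd \<omega> (idx 1 j i)) (share \<omega> i)
       - poly_hash L ((snd \<omega> (idx 1 j i) + x) mod p) (share \<omega> i)) mod p))" for x \<omega>
  have sh: "share (\<sigma> x \<omega>) = share \<omega>" for x \<omega>
    by (intro ext share_cong) (auto simp: \<sigma>_def)
  have into: "\<sigma> x \<omega> \<in> \<Omega>" if "\<omega> \<in> \<Omega>" for x \<omega>
    unfolding \<sigma>_def mem_Times_iff fst_conv snd_conv
    by (intro conjI fun_upd_in lt) (use that in \<open>simp_all only: mem_Times_iff\<close>)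
  have inj: "inj_on (\<sigma> x) \<Omega>" for x
  proof (rule inj_onI)
    fix \<omega> \<omega>' assume \<omega>: "\<omega> \<in> \<Omega>" "\<omega>' \<in> \<Omega>" and eq: "\<sigma> x \<omega> = \<sigma> x \<omega>'"
    have V: "snd \<omega> \<in> V" "snd \<omega>' \<in> V" using \<omega> by (simp_all only: mem_Times_iff)
    have s: "share \<omega> = share \<omega>'" using eq sh by metis
    have f: "fst \<omega> = fst \<omega>'" using eq by (simp add: \<sigma>_def)
    have other: "snd \<omega> n = snd \<omega>' n" if "n \<noteq> idx 1 j i" "n \<noteq> idx 2 j i" for n
      using arg_cong[OF eq, of "\<lambda>x. snd x n"] that by (simp add: \<sigma>_def)
    have "[snd \<omega> (idx 1 j i) + x = snd \<omega>' (idx 1 j i) + x] (mod p)"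
      using arg_cong[OF eq, of "\<lambda>x. snd x (idx 1 j i)"] by (simp add: \<sigma>_def cong_def)
    then have one: "snd \<omega> (idx 1 j i) = snd \<omega>' (idx 1 j i)"
      using V lt by (intro range_eq_if_cong nth_range) (simp_all add: cong_add_rcancel)
    have "[snd \<omega> (idx 2 j i) = snd \<omega>' (idx 2 j i)] (mod p)"
      using arg_cong[OF eq, of "\<lambda>x. snd x (idx 2 j i)"] one s
      by (simp add: \<sigma>_def mod_eq_dvd_iff cong_iff_dvd_diff)
    then have "snd \<omega> (idx 2 j i) = snd \<omega>' (idx 2 j i)"
      using V lt by (intro range_eq_if_cong nth_range)
    then have "snd \<omega> = snd \<omega>'" using one other by (intro ext) metis
    then show "\<omega> = \<omega>'" using f by (simp add: prod_eq_iff)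
  qed
  have tg: "tag (\<sigma> x \<omega>) i j = tag \<omega> i j" for x \<omega>
    unfolding tag_def sh by (simp add: \<sigma>_def mod_simps algebra_simps)
  \<comment> \<open>The varied key and mask enter packets other than \<open>j\<close> only through
    \<open>tag \<omega> i j\<close>, which is preserved.\<close>
  have pk: "packet (\<sigma> x \<omega>) k = packet \<omega> k" if k: "k \<noteq> j" "k < d" for x \<omega> k
  proof (rule packet_cong)
    show "tag (\<sigma> x \<omega>) k j' = tag \<omega> k j'" for j'
    proof (cases "k = i \<and> j' = j")
      case True
      then show ?thesis using tg by simp
    next
      case False
      then show ?thesis by (intro tag_cong) (auto simp: sh, auto simp: \<sigma>_def)
    qed
  qed (use k in \<open>auto simp: sh\<close>, use k in \<open>auto simp: \<sigma>_def\<close>)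
  have yi: "y (\<sigma> x \<omega>) i = y \<omega> i" if "\<omega> \<in> \<Omega>" for x \<omega>
  proof -
    have "obs (\<sigma> x \<omega>) = obs \<omega>"
    proof (rule obs_cong[OF into[OF that] that])
      fix k assume "k \<in> A"
      then have "k \<noteq> j" "k < d" using ij A by auto
      then show "packet (\<sigma> x \<omega>) k = packet \<omega> k" by (rule pk)
    qed
    then show ?thesis unfolding y_def using pk[OF ij(3,1)] by simp
  qed
  have "card {\<omega> \<in> \<Omega>. vouches j (packet \<omega> j) i (y \<omega> i) \<and> (\<exists>l<L. y \<omega> i l \<noteq> share \<omega> i l)} * card {0..<p} \<le> L * card \<Omega>"
  proof (rule card_bad_le_if_orbits[where \<sigma> = \<sigma>])
    fix \<omega> assume \<omega>: "\<omega> \<in> \<Omega>"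
    \<comment> \<open>\<open>?P c\<close> is acceptance under the key \<open>c\<close> after the
      compensating mask is expressed through the old key \<open>?a\<close>: a hash collision whose
      offset does not depend on \<open>c\<close>. The forged packet is the same for all
      \<open>x\<close>.\<close>
    let ?a = "snd \<omega> (idx 1 j i)"
    let ?P = "\<lambda>c. [poly_hash L c (y \<omega> i) = poly_hash L c (share \<omega> i) +
      (y \<omega> i (L + 2 * d + j) - snd \<omega> (idx 2 j i) - poly_hash L ?a (share \<omega> i))] (mod p)"
    show "card {x \<in> {0..<p}. vouches j (packet (\<sigma> x \<omega>) j) i (y (\<sigma> x \<omega>) i) \<and> (\<exists>l<L. y (\<sigma> x \<omega>) i l \<noteq> share (\<sigma> x \<omega>) i l)} \<le> L"
    proof (cases "\<exists>l<L. y \<omega> i l \<noteq> share \<omega> i l")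
      case True
      then obtain l where l: "l < L" "y \<omega> i l \<noteq> share \<omega> i l" by auto
      have "y \<omega> i l \<in> {0..<p}" using PiE_mem[OF y_in[OF \<omega> ij(1)], of l] l by simp
      then have "\<not> [y \<omega> i l = share \<omega> i l] (mod p)"
        using l(2) share_range range_eq_if_cong by blast
      from card_hash_collisions_le[where x = "share \<omega> i" and y = "y \<omega> i", OF prime l(1) this]
      have "card {c \<in> {0..<p}. ?P c} \<le> L" .
      then have "card {x \<in> {0..<p}. ?P ((?a + x) mod p)} \<le> L" by (rule card_shifted_roots_le[OF p_pos])
      moreover have "?P ((?a + x) mod p)" if "vouches j (packet (\<sigma> x \<omega>) j) i (y (\<sigma> x \<omega>) i)" for x
      proof -
        have "[poly_hash L ((?a + x) mod p) (y \<omega> i) + (snd \<omega> (idx 2 j i) + poly_hash L ?a (share \<omega> i)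
       - poly_hash L ((?a + x) mod p) (share \<omega> i)) = y \<omega> i (L + 2 * d + j)] (mod p)"
          using that ij unfolding vouches_def yi[OF \<omega>] packet_key_a[OF ij(1)] packet_key_b[OF ij(1)]
          by (simp add: \<sigma>_def cong_def mod_simps)
        then show ?thesis by (simp add: cong_iff_dvd_diff algebra_simps)
      qed
      ultimately show ?thesis
        by (elim order_trans[rotated], intro card_mono) (auto intro: finite_subset[of _ "{0..<p}"])
    next
      case False
      then have "{x \<in> {0..<p}. vouches j (packet (\<sigma> x \<omega>) j) i (y (\<sigma> x \<omega>) i) \<and> (\<exists>l<L. y (\<sigma> x \<omega>) i l \<noteq> share (\<sigma> x \<omega>) i l)} = {}"
        using yi[OF \<omega>] sh by auto
      then show ?thesis by (simp only: card.empty)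
    qed
  next
    show "finite \<Omega>" using finite_V by simp
    show "inj_on (\<sigma> x) \<Omega>" "\<sigma> x ` \<Omega> \<subseteq> \<Omega>" for x using inj into by (simp, intro image_subsetI)
  qed simp
  then show ?thesis by simp
qed

text \<open>Only the manipulation detection key of packet \<open>j\<close> is varied. It enters
  nothing but the last two symbols of that packet, so the view, and with it the additive error
  \<open>\<delta>\<close>, stays constant while the key runs through the field.\<close>

lemma tampering_bound:
  assumes j: "j < d" "j \<notin> A"
    and additive: "\<And>\<omega>. \<omega> \<in> \<Omega> \<Longrightarrow> \<exists>\<delta>. \<forall>x\<in>{..<N} \<rightarrow>\<^sub>E {0..<p}. \<forall>n<N. g (obs \<omega>) j x n = (x n + \<delta> n) mod p"
  shows "card {\<omega> \<in> \<Omega>. self_ok (y \<omega> j) \<and> (\<exists>n<L + 2 * d. y \<omega> j n \<noteq> packet \<omega> j n)} * nat p \<le> (L + 2 * d + 2) * card \<Omega>"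
proof -
  have lt: "idx 3 j 0 < rlen" using j by (auto intro!: idx_less)
  define \<sigma> :: "int \<Rightarrow> nat \<times> symbols \<Rightarrow> nat \<times> symbols" where "\<sigma> x \<omega> = (fst \<omega>, (snd \<omega>)(idx 3 j 0 := (snd \<omega> (idx 3 j 0) + x) mod p))" for x \<omega>
  have into: "\<sigma> x \<omega> \<in> \<Omega>" if "\<omega> \<in> \<Omega>" for x \<omega>
    unfolding \<sigma>_def mem_Times_iff fst_conv snd_conv
    by (intro conjI fun_upd_in lt) (use that in \<open>simp_all only: mem_Times_iff\<close>)
  have inj: "inj_on (\<sigma> x) \<Omega>" for x
  proof (rule inj_onI)
    fix \<omega> \<omega>' assume \<omega>: "\<omega> \<in> \<Omega>" "\<omega>' \<in> \<Omega>" and eq: "\<sigma> x \<omega> = \<sigma> x \<omega>'"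
    have V: "snd \<omega> \<in> V" "snd \<omega>' \<in> V" using \<omega> by (simp_all only: mem_Times_iff)
    have f: "fst \<omega> = fst \<omega>'" using eq by (simp add: \<sigma>_def)
    have other: "snd \<omega> n = snd \<omega>' n" if "n \<noteq> idx 3 j 0" for n
      using arg_cong[OF eq, of "\<lambda>x. snd x n"] that by (simp add: \<sigma>_def)
    have "[snd \<omega> (idx 3 j 0) + x = snd \<omega>' (idx 3 j 0) + x] (mod p)"
      using arg_cong[OF eq, of "\<lambda>x. snd x (idx 3 j 0)"] by (simp add: \<sigma>_def cong_def)
    then have "snd \<omega> (idx 3 j 0) = snd \<omega>' (idx 3 j 0)"
      using V lt by (intro range_eq_if_cong nth_range) (simp_all add: cong_add_rcancel)
    then have "snd \<omega> = snd \<omega>'" using other by (intro ext) metis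
    then show "\<omega> = \<omega>'" using f by (simp add: prod_eq_iff)
  qed
  have sh: "share (\<sigma> x \<omega>) = share \<omega>" for x \<omega>
    by (intro ext share_cong) (auto simp: \<sigma>_def)
  have pk: "packet (\<sigma> x \<omega>) k = packet \<omega> k" if k: "k \<noteq> j" "k < d" for x \<omega> k
    by (rule packet_cong) (use k in \<open>auto simp: sh intro!: tag_cong\<close>, use k in \<open>auto simp: \<sigma>_def\<close>)
  have bd: "body (\<sigma> x \<omega>) j = body \<omega> j" for x \<omega>
    by (intro ext) (auto simp: body_def sh, auto simp: \<sigma>_def)
  have ob: "obs (\<sigma> x \<omega>) = obs \<omega>" if "\<omega> \<in> \<Omega>" for x \<omega>
  proof (rule obs_cong[OF into[OF that] that])
    fix k assume "k \<in> A"
    then have "k \<noteq> j" "k < d" using j A by auto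
    then show "packet (\<sigma> x \<omega>) k = packet \<omega> k" by (rule pk)
  qed
  have "card {\<omega> \<in> \<Omega>. self_ok (y \<omega> j) \<and> (\<exists>n<L + 2 * d. y \<omega> j n \<noteq> packet \<omega> j n)} * card {0..<p} \<le> (L + 2 * d + 2) * card \<Omega>"
  proof (rule card_bad_le_if_orbits[where \<sigma> = \<sigma>])
    fix \<omega> assume \<omega>: "\<omega> \<in> \<Omega>"
    obtain \<delta> where \<delta>: "\<And>x n. x \<in> {..<N} \<rightarrow>\<^sub>E {0..<p} \<Longrightarrow> n < N \<Longrightarrow> g (obs \<omega>) j x n = (x n + \<delta> n) mod p"
      using additive[OF \<omega>] by blast
    define b where "b n = (body \<omega> j n + \<delta> n) mod p" for n
    let ?c = "snd \<omega> (idx 3 j 0)"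
    \<comment> \<open>The error on the key symbol is the change of key, the error on the check
      symbol is the offset, and the received body \<open>b\<close> is constant along the
      orbit.\<close>
    let ?P = "\<lambda>c. [(c + \<delta> (L + 3 * d)) ^ (L + 2 * d + 2) + poly_hash (L + 2 * d) (c + \<delta> (L + 3 * d)) b
      = c ^ (L + 2 * d + 2) + poly_hash (L + 2 * d) c (body \<omega> j) + \<delta> (L + 3 * d + 1)] (mod p)"
    have y\<sigma>: "y (\<sigma> x \<omega>) j n = (packet (\<sigma> x \<omega>) j n + \<delta> n) mod p" if "n < N" for x n
      unfolding y_def ob[OF \<omega>] by (rule \<delta>[OF packet_in_vecs[OF into[OF \<omega>] j(1)] that])
    have yb: "y (\<sigma> x \<omega>) j n = b n" if "n < L + 2 * d" for x n
      using that by (simp add: y\<sigma> packet_body bd b_def)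
    show "card {x \<in> {0..<p}. self_ok (y (\<sigma> x \<omega>) j) \<and> (\<exists>n<L + 2 * d. y (\<sigma> x \<omega>) j n \<noteq> packet (\<sigma> x \<omega>) j n)} \<le> L + 2 * d + 2"
    proof (cases "\<exists>n<L + 2 * d. b n \<noteq> body \<omega> j n")
      case True
      then obtain l where l: "l < L + 2 * d" "b l \<noteq> body \<omega> j l" by auto
      have "body \<omega> j l \<in> {0..<p}"
        using PiE_mem[OF packet_in_vecs[OF \<omega> j(1)], of l] l by (simp add: packet_body)
      moreover have "b l \<in> {0..<p}" using p_pos by (simp add: b_def)
      ultimately have "\<not> [b l = body \<omega> j l] (mod p)"
        using l(2) range_eq_if_cong by blast
      moreover have "int (L + 2 * d) + 2 < p" using large by simp
      ultimately have "card {c \<in> {0..<p}. ?P c} \<le> L + 2 * d + 2"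
        using l(1) by (intro card_amd_forgeries_le[OF prime, where l = l])
      then have "card {x \<in> {0..<p}. ?P ((?c + x) mod p)} \<le> L + 2 * d + 2" by (rule card_shifted_roots_le[OF p_pos])
      moreover have "?P ((?c + x) mod p)" if ok: "self_ok (y (\<sigma> x \<omega>) j)" for x
      proof -
        let ?a = "(?c + x) mod p"
        have a: "y (\<sigma> x \<omega>) j (L + 3 * d) = (?a + \<delta> (L + 3 * d)) mod p"
          by (simp add: y\<sigma> packet_self) (simp add: \<sigma>_def)
        have u: "y (\<sigma> x \<omega>) j (L + 3 * d + 1) = ((?a ^ (L + 2 * d + 2) + poly_hash (L + 2 * d) ?a (body \<omega> j)) mod p + \<delta> (L + 3 * d + 1)) mod p"
          by (simp only: y\<sigma> packet_check bd) (simp add: \<sigma>_def)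
        have "[(?a + \<delta> (L + 3 * d)) ^ (L + 2 * d + 2) + poly_hash (L + 2 * d) (?a + \<delta> (L + 3 * d)) b
          = y (\<sigma> x \<omega>) j (L + 3 * d) ^ (L + 2 * d + 2) + poly_hash (L + 2 * d) (y (\<sigma> x \<omega>) j (L + 3 * d)) b] (mod p)"
          unfolding a by (intro cong_add cong_pow poly_hash_mod_cong) (simp_all add: cong_def)
        also have "poly_hash (L + 2 * d) (y (\<sigma> x \<omega>) j (L + 3 * d)) b = poly_hash (L + 2 * d) (y (\<sigma> x \<omega>) j (L + 3 * d)) (y (\<sigma> x \<omega>) j)"
          by (rule poly_hash_cong) (simp add: yb)
        also have "[y (\<sigma> x \<omega>) j (L + 3 * d) ^ (L + 2 * d + 2) + poly_hash (L + 2 * d) (y (\<sigma> x \<omega>) j (L + 3 * d)) (y (\<sigma> x \<omega>) j)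
            = y (\<sigma> x \<omega>) j (L + 3 * d + 1)] (mod p)"
          using ok by (simp only: self_ok_def)
        also have "[y (\<sigma> x \<omega>) j (L + 3 * d + 1) = ?a ^ (L + 2 * d + 2) + poly_hash (L + 2 * d) ?a (body \<omega> j) + \<delta> (L + 3 * d + 1)] (mod p)"
          unfolding u by (simp only: cong_def mod_simps mod_mod_trivial)
        finally show ?thesis .
      qed
      ultimately show ?thesis
        by (elim order_trans[rotated], intro card_mono) (auto intro: finite_subset[of _ "{0..<p}"])
    next
      case False
      then have "{x \<in> {0..<p}. self_ok (y (\<sigma> x \<omega>) j) \<and> (\<exists>n<L + 2 * d. y (\<sigma> x \<omega>) j n \<noteq> packet (\<sigma> x \<omega>) j n)} = {}"
        by (auto simp: yb packet_body bd)
      then show ?thesis by (simp only: card.empty)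
    qed
  next
    show "finite \<Omega>" using finite_V by simp
    show "inj_on (\<sigma> x) \<Omega>" "\<sigma> x ` \<Omega> \<subseteq> \<Omega>" for x using inj into by (simp, intro image_subsetI)
  qed simp
  then show ?thesis by simp
qed

text \<open>Union bound over \<open>d * d\<close> forgery events and \<open>d\<close> tampering
  events. The second alternative of \<open>mode\<close> serves overwrite jamming, where trust comes
  from counting packets and not from the check symbol.\<close>

lemma decoding_error_bound:
  assumes mode: "(\<forall>\<omega>\<in>\<Omega>. \<forall>i<d. \<exists>\<delta>. \<forall>x\<in>{..<N} \<rightarrow>\<^sub>E {0..<p}. \<forall>n<N. g (obs \<omega>) i x n = (x n + \<delta> n) mod p)
    \<or> card (A \<union> B) < z + R"
  shows "card {\<omega> \<in> \<Omega>. dec (y \<omega>) \<noteq> fst \<omega>} * nat p \<le> (d * d * L + d * (L + 2 * d + 2)) * card \<Omega>"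
proof -
  define E1 where "E1 q = (case q of (i, j) \<Rightarrow> if i \<noteq> j \<and> j \<notin> A
      then {\<omega> \<in> \<Omega>. vouches j (packet \<omega> j) i (y \<omega> i) \<and> (\<exists>l<L. y \<omega> i l \<noteq> share \<omega> i l)} else {})" for q
  \<comment> \<open>Left empty in the case settled by counting, where additivity may fail.\<close>
  define E2 where "E2 j = (if j \<notin> A \<and> \<not> card (A \<union> B) < z + R
      then {\<omega> \<in> \<Omega>. self_ok (y \<omega> j) \<and> (\<exists>n<L + 2 * d. y \<omega> j n \<noteq> packet \<omega> j n)} else {})" for j
  have E1: "card (E1 q) * nat p \<le> L * card \<Omega>" if "q \<in> {..<d} \<times> {..<d}" for q
    using that by (cases q) (auto simp: E1_def simp del: card_cartesian_product intro!: forgery_bound)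
  have E2: "card (E2 j) * nat p \<le> (L + 2 * d + 2) * card \<Omega>" if "j \<in> {..<d}" for j
  proof (cases "j \<notin> A \<and> \<not> card (A \<union> B) < z + R")
    case True
    then have "card {\<omega> \<in> \<Omega>. self_ok (y \<omega> j) \<and> (\<exists>n<L + 2 * d. y \<omega> j n \<noteq> packet \<omega> j n)} * nat p \<le> (L + 2 * d + 2) * card \<Omega>"
      using mode that by (intro tampering_bound) auto
    then show ?thesis using True by (simp only: E2_def if_True simp_thms)
  next
    case False
    then show ?thesis by (simp only: E2_def if_False card.empty)
  qed
  have "{\<omega> \<in> \<Omega>. dec (y \<omega>) \<noteq> fst \<omega>} \<subseteq> (\<Union>q\<in>{..<d} \<times> {..<d}. E1 q) \<union> (\<Union>j<d. E2 j)"
  proof (rule subsetI, rule ccontr)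
    fix \<omega> assume "\<omega> \<in> {\<omega> \<in> \<Omega>. dec (y \<omega>) \<noteq> fst \<omega>}" and
      notin: "\<omega> \<notin> (\<Union>q\<in>{..<d} \<times> {..<d}. E1 q) \<union> (\<Union>j<d. E2 j)"
    then have \<omega>: "\<omega> \<in> \<Omega>" "dec (y \<omega>) \<noteq> fst \<omega>" by blast+
    have "dec (y \<omega>) = fst \<omega>"
    proof (rule dec_eq[OF \<omega>(1) B])
      show "y \<omega> i = packet \<omega> i" if "i < d" "i \<notin> B" for i
        unfolding y_def using that by (rule g_unjammed)
      show "\<forall>l<L. y \<omega> i l = share \<omega> i l"
        if "i < d" "j < d" "j \<notin> A" "i \<noteq> j" "vouches j (packet \<omega> j) i (y \<omega> i)" for i j
      proof -
        have "\<omega> \<notin> E1 (i, j)" using notin that by blast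
        then show ?thesis using that \<omega>(1) unfolding E1_def by auto
      qed
      show "\<exists>j\<in>S. j \<notin> A \<and> (\<forall>n<L + 2 * d. y \<omega> j n = packet \<omega> j n)"
        if S: "S \<subseteq> {..<d}" "z + R \<le> card S" "\<forall>i\<in>S. self_ok (y \<omega> i)" for S
      proof (cases "card (A \<union> B) < z + R")
        \<comment> \<open>\<open>S\<close> is too large to consist of seen or jammed packets
          only.\<close>
        case True
        have "finite (A \<union> B)" using A B finite_subset by blast
        then have "\<not> S \<subseteq> A \<union> B" using card_mono[of "A \<union> B" S] True S by auto
        then obtain j where j: "j \<in> S" "j \<notin> A" "j \<notin> B" by blast
        then have "y \<omega> j = packet \<omega> j" unfolding y_def using S by (intro g_unjammed) auto
        then show ?thesis using j by auto
      next
        \<comment> \<open>As \<open>R\<close> is positive, \<open>S\<close> has more than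
          \<open>z\<close> elements and contains an unseen packet; passing the self-check outside
          \<open>E2\<close> makes its body genuine.\<close>
        case False
        have "finite A" using A finite_subset by blast
        then have "\<not> S \<subseteq> A" using card_mono[of A S] A R S by auto
        then obtain j where j: "j \<in> S" "j \<notin> A" by blast
        then have "\<omega> \<notin> E2 j" using notin S by blast
        then have "\<forall>n<L + 2 * d. y \<omega> j n = packet \<omega> j n"
          using False \<omega>(1) S j by (auto simp: E2_def)
        then show ?thesis using j by blast
      qed
    qed
    then show False using \<omega>(2) by contradiction
  qed
  moreover have fin: "finite (E1 q)" "finite (E2 j)" for q j
    using finite_V by (auto simp: E1_def E2_def split: prod.split)
  ultimately have "card {\<omega> \<in> \<Omega>. dec (y \<omega>) \<noteq> fst \<omega>} \<le> card ((\<Union>q\<in>{..<d} \<times> {..<d}. E1 q) \<union> (\<Union>j<d. E2 j))"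
    by (intro card_mono) auto
  also have "\<dots> \<le> (\<Sum>q\<in>{..<d} \<times> {..<d}. card (E1 q)) + (\<Sum>j<d. card (E2 j))"
    by (intro order_trans[OF card_Un_le] add_mono card_UN_le) auto
  finally have "card {\<omega> \<in> \<Omega>. dec (y \<omega>) \<noteq> fst \<omega>} * nat p
      \<le> ((\<Sum>q\<in>{..<d} \<times> {..<d}. card (E1 q)) + (\<Sum>j<d. card (E2 j))) * nat p"
    by (rule mult_le_mono1)
  also have "\<dots> = (\<Sum>q\<in>{..<d} \<times> {..<d}. card (E1 q) * nat p) + (\<Sum>j<d. card (E2 j) * nat p)"
    by (simp only: distrib_right sum_distrib_right)
  also have "\<dots> \<le> (\<Sum>q\<in>{..<d} \<times> {..<d}. L * card \<Omega>) + (\<Sum>j<d. (L + 2 * d + 2) * card \<Omega>)"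
    by (intro add_mono sum_mono E1 E2)
  also have "\<dots> = (d * d * L + d * (L + 2 * d + 2)) * card \<Omega>"
    by (simp add: algebra_simps)
  finally show ?thesis .
qed

end


section \<open>Routing along disjoint paths\<close>

text \<open>Disjointness is expressed by tails: the tail of a non-first arc determines path and
  position, which also excludes repetitions. Direct edges from \<open>s\<close> to \<open>t\<close>
  have no inner node and are kept apart by their first arcs.\<close>

locale path_system = network G s t for G :: "('v, 'e) pre_digraph" (structure) and s t :: 'v +
  fixes d :: nat and P :: "nat \<Rightarrow> 'e list"
  assumes P_nonempty: "i < d \<Longrightarrow> P i \<noteq> []"
    and P_arcs: "i < d \<Longrightarrow> k < length (P i) \<Longrightarrow> P i ! k \<in> arcs G"
    and P_first: "i < d \<Longrightarrow> tail G (P i ! 0) = s"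
    and P_step: "i < d \<Longrightarrow> Suc k < length (P i) \<Longrightarrow> tail G (P i ! Suc k) = head G (P i ! k)"
    and P_last: "i < d \<Longrightarrow> head G (P i ! (length (P i) - 1)) = t"
    and P_first_inj: "i < d \<Longrightarrow> j < d \<Longrightarrow> P i ! 0 = P j ! 0 \<Longrightarrow> i = j"
    and P_inner_inj: "i < d \<Longrightarrow> j < d \<Longrightarrow> Suc k < length (P i) \<Longrightarrow> Suc k' < length (P j) \<Longrightarrow>
      tail G (P i ! Suc k) = tail G (P j ! Suc k') \<Longrightarrow> i = j \<and> k = k'"
begin

lemma inner_ne_source: "i < d \<Longrightarrow> Suc k < length (P i) \<Longrightarrow> tail G (P i ! Suc k) \<noteq> s"
  using P_step[of i k] P_arcs[of i k] source_no_in_arcs by (auto simp: in_arcs_def)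

lemma P_inj:
  assumes "i < d" "j < d" "k < length (P i)" "k' < length (P j)" "P i ! k = P j ! k'"
  shows "i = j \<and> k = k'"
proof (cases k; cases k')
  fix a assume "k = 0" "k' = Suc a"
  then show ?thesis using assms P_first[of i] inner_ne_source[of j a] by simp
next
  fix a assume "k' = 0" "k = Suc a"
  then show ?thesis using assms P_first[of j] inner_ne_source[of i a] by simp
next
  fix a b assume "k = Suc a" "k' = Suc b"
  then show ?thesis using assms P_inner_inj[of i j a b] by simp
qed (use assms P_first_inj in auto)

text \<open>Tails of non-first arcs are the inner nodes of a path, so neither \<open>s\<close> nor
  \<open>t\<close> ever contributes.\<close>

definition hit :: "'v set \<Rightarrow> nat set" where
  "hit U = {i. i < d \<and> (\<exists>k. Suc k < length (P i) \<and> tail G (P i ! Suc k) \<in> U)}"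

lemma hit_Un: "hit (U \<union> W) = hit U \<union> hit W"
  by (auto simp: hit_def)

lemma hit_subset: "hit U \<subseteq> {..<d}"
  by (auto simp: hit_def)

text \<open>A node is an inner node of at most one path, so each node under attack costs at most one
  packet.\<close>

lemma card_hit_le:
  assumes "finite U"
  shows "card (hit U) \<le> card U"
proof -
  have "\<forall>i\<in>hit U. \<exists>k. Suc k < length (P i) \<and> tail G (P i ! Suc k) \<in> U"
    by (auto simp: hit_def)
  then obtain k where k: "\<forall>i\<in>hit U. Suc (k i) < length (P i) \<and> tail G (P i ! Suc (k i)) \<in> U"
    by metis
  have "inj_on (\<lambda>i. tail G (P i ! Suc (k i))) (hit U)"
  proof (rule inj_onI)
    fix i j assume ij: "i \<in> hit U" "j \<in> hit U" "tail G (P i ! Suc (k i)) = tail G (P j ! Suc (k j))"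
    then have "i < d" "j < d" using hit_subset by auto
    from P_inner_inj[OF this _ _ ij(3)] show "i = j" using k ij by simp
  qed
  then show ?thesis using k assms by (intro card_inj_on_le) auto
qed

end

section \<open>The routed code\<close>

definition zero_vec :: "int ring \<Rightarrow> nat \<Rightarrow> symbols" where
  "zero_vec F n = (\<lambda>_\<in>{..<n}. \<zero>\<^bsub>F\<^esub>)"

text \<open>Packets and decoder are arbitrary, so that the same construction without any paths also
  supplies the code of rate 0.\<close>

locale routing = path_system +
  fixes F :: "int ring" and n rl :: nat and M :: "nat set"
    and pk :: "nat \<times> symbols \<Rightarrow> nat \<Rightarrow> symbols" and dc :: "(nat \<Rightarrow> symbols) \<Rightarrow> nat"
  assumes field: "field F" and finite_field: "finite (carrier F)" and n: "0 < n"
    and M: "finite M" "M \<noteq> {}"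
    and pk: "\<And>\<omega> i. \<omega> \<in> M \<times> vecs F rl \<Longrightarrow> i < d \<Longrightarrow> pk \<omega> i \<in> vecs F n"
    and dc: "\<And>y. dc y \<in> M"
begin

definition code :: "'b net_code" where
  "code = \<lparr>fld = F, blen = n, rlen = rl, msgs = M,
     src_enc = (\<lambda>e \<omega>. if \<exists>i<d. e = P i ! 0 then pk \<omega> (THE i. i < d \<and> e = P i ! 0) else zero_vec F n),
     relay_enc = (\<lambda>e f. if \<exists>i k. i < d \<and> Suc k < length (P i) \<and> e = P i ! Suc k
        then f (THE a. \<exists>i k. i < d \<and> Suc k < length (P i) \<and> e = P i ! Suc k \<and> a = P i ! k)
        else zero_vec F n),
     decode = (\<lambda>f. dc (\<lambda>i. f (P i ! (length (P i) - 1))))\<rparr>"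

lemma code_simps [simp]: "fld code = F" "blen code = n" "net_code.rlen code = rl" "msgs code = M"
  "decode code f = dc (\<lambda>i. f (P i ! (length (P i) - 1)))"
  by (simp_all add: code_def)

lemma source_data_code: "source_data code = M \<times> vecs F rl"
  by (simp add: source_data_def)

lemma zero_vec_in: "zero_vec F n \<in> vecs F n"
proof -
  interpret field F by (rule field)
  show ?thesis by (auto simp: zero_vec_def vecs_def)
qed

lemma src_enc_first: "i < d \<Longrightarrow> src_enc code (P i ! 0) \<omega> = pk \<omega> i"
proof -
  assume i: "i < d"
  then have "(THE j. j < d \<and> P i ! 0 = P j ! 0) = i" using P_first_inj by (intro the_equality) auto
  then show ?thesis using i by (auto simp: code_def)
qed

lemma src_enc_off: "(\<And>i. i < d \<Longrightarrow> e \<noteq> P i ! 0) \<Longrightarrow> src_enc code e \<omega> = zero_vec F n"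
  by (auto simp: code_def)

lemma relay_enc_inner: "i < d \<Longrightarrow> Suc k < length (P i) \<Longrightarrow> relay_enc code (P i ! Suc k) f = f (P i ! k)"
proof -
  assume i: "i < d" "Suc k < length (P i)"
  then have "(THE a. \<exists>j l. j < d \<and> Suc l < length (P j) \<and> P i ! Suc k = P j ! Suc l \<and> a = P j ! l) = P i ! k"
    using P_inj by (intro the_equality) blast+
  then show ?thesis using i by (auto simp: code_def)
qed

lemma relay_enc_off:
  "(\<And>i k. i < d \<Longrightarrow> Suc k < length (P i) \<Longrightarrow> e \<noteq> P i ! Suc k) \<Longrightarrow> relay_enc code e f = zero_vec F n"
  unfolding code_def net_code.simps by (subst if_not_P) blast+

lemma valid_code_code: "valid_code G s t code"
proof -
  have "src_enc code e \<omega> \<in> vecs F n" if "\<omega> \<in> source_data code" for e \<omega>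
    using that pk src_enc_first src_enc_off[of e \<omega>] zero_vec_in unfolding source_data_code by metis
  moreover have "relay_enc code e f \<in> vecs F n" if "f \<in> in_arcs G (tail G e) \<rightarrow>\<^sub>E vecs F n" for e f
  proof (cases "\<exists>i k. i < d \<and> Suc k < length (P i) \<and> e = P i ! Suc k")
    case True
    then obtain i k where e: "i < d" "Suc k < length (P i)" "e = P i ! Suc k" by auto
    then have "P i ! k \<in> in_arcs G (tail G e)" using P_step P_arcs[of i k] by (simp add: in_arcs_def)
    then show ?thesis using that e by (auto simp: relay_enc_inner)
  next
    case False
    then show ?thesis using relay_enc_off[of e f] zero_vec_in by auto
  qed
  ultimately show ?thesis
    using field finite_field n M dc by (auto simp: valid_code_def)
qed

end

section \<open>Received symbols under an adversarial strategy\<close>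

locale attack = routing G s t d P F n rl M pk dc
    for G :: "('v, 'e) pre_digraph" (structure) and s t d P F n rl M pk dc +
  fixes J :: jamming and \<beta> :: "'v config" and \<phi> :: "('v, 'e) strategy"
  assumes source_safe: "s \<notin> jam_nodes \<beta>" and obs_verts: "obs_nodes \<beta> \<subseteq> verts G"
    and valid: "valid_strategy J G s t code \<beta> \<phi>"
begin

abbreviation "fb \<equiv> feedback_nodes t \<beta>"

text \<open>The injections are a separate argument \<open>Z\<close>, which cuts the feedback loop.
  Position 0 is never jammed because the first arc leaves the source.\<close>

primrec chan :: "nat \<Rightarrow> nat \<Rightarrow> symbols \<Rightarrow> ('e \<Rightarrow> symbols) \<Rightarrow> symbols" where
  "chan i 0 x Z = x"
| "chan i (Suc k) x Z = (if tail G (P i ! Suc k) \<in> jam_nodes \<beta>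
     then jam J code (chan i k x Z) (Z (P i ! Suc k)) else chan i k x Z)"

text \<open>The solution of the transmission equations with the injections frozen at
  \<open>Z\<close>; arcs off the paths then carry nothing that depends on the source.\<close>

definition flow :: "(nat \<Rightarrow> symbols) \<Rightarrow> ('e \<Rightarrow> symbols) \<Rightarrow> 'e \<Rightarrow> symbols" where
  "flow X Z = (\<lambda>e\<in>arcs G.
     if \<exists>i k. i < d \<and> k < length (P i) \<and> e = P i ! k
     then (THE x. \<exists>i k. i < d \<and> k < length (P i) \<and> e = P i ! k \<and> x = chan i k (X i) Z)
     else if tail G e \<in> jam_nodes \<beta> then jam J code (zero_vec F n) (Z e) else zero_vec F n)"

lemma flow_on: "i < d \<Longrightarrow> k < length (P i) \<Longrightarrow> flow X Z (P i ! k) = chan i k (X i) Z"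
proof -
  assume i: "i < d" "k < length (P i)"
  then have "(THE x. \<exists>j l. j < d \<and> l < length (P j) \<and> P i ! k = P j ! l \<and> x = chan j l (X j) Z) = chan i k (X i) Z"
    using P_inj by (intro the_equality) blast+
  then show ?thesis using i P_arcs by (auto simp: flow_def)
qed

lemma flow_off:
  assumes "e \<in> arcs G" "\<And>i k. i < d \<Longrightarrow> k < length (P i) \<Longrightarrow> e \<noteq> P i ! k"
  shows "flow X Z e = (if tail G e \<in> jam_nodes \<beta> then jam J code (zero_vec F n) (Z e) else zero_vec F n)"
proof -
  have "\<not> (\<exists>i k. i < d \<and> k < length (P i) \<and> e = P i ! k)" using assms(2) by blast
  then show ?thesis using assms(1) by (simp only: flow_def restrict_apply' if_False)
qed

lemma sent_first: "i < d \<Longrightarrow> sent G s code \<omega> Y (P i ! 0) = pk \<omega> i"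
  using P_first[of i] src_enc_first[of i \<omega>] by (simp add: sent_def)

lemma sent_inner: "i < d \<Longrightarrow> Suc k < length (P i) \<Longrightarrow> sent G s code \<omega> Y (P i ! Suc k) = Y (P i ! k)"
  using P_step[of i k] P_arcs[of i k] inner_ne_source[of i k] relay_enc_inner[of i k]
  by (simp add: sent_def node_info_def in_arcs_def)

lemma sent_off: "(\<And>i k. i < d \<Longrightarrow> k < length (P i) \<Longrightarrow> e \<noteq> P i ! k) \<Longrightarrow> sent G s code \<omega> Y e = zero_vec F n"
proof -
  assume *: "\<And>i k. i < d \<Longrightarrow> k < length (P i) \<Longrightarrow> e \<noteq> P i ! k"
  have "e \<noteq> P i ! 0" if "i < d" for i using *[of i 0] that P_nonempty by auto
  then show ?thesis using * by (auto simp: sent_def intro!: src_enc_off relay_enc_off)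
qed

text \<open>Injections may depend on symbols further downstream, so the defining equations are
  circular. Solving them along each path with the injections taken as given leaves the circularity
  in one fixed-point equation for \<open>Y\<close>.\<close>

lemma transmission_iff_flow:
  assumes "\<omega> \<in> source_data code" "Y \<in> arcs G \<rightarrow>\<^sub>E vecs F n"
  shows "transmission J G s t code \<beta> \<phi> \<omega> Y \<longleftrightarrow> Y = flow (pk \<omega>) (\<phi> (nodes_info G Y fb))"
    (is "_ \<longleftrightarrow> Y = flow _ ?Z")
proof
  assume tr: "transmission J G s t code \<beta> \<phi> \<omega> Y"
  then have Y: "Y e = (if tail G e \<in> jam_nodes \<beta> then jam J code (sent G s code \<omega> Y e) (?Z e)
      else sent G s code \<omega> Y e)" if "e \<in> arcs G" for e
    using that by (simp add: transmission_def)
  have on: "Y (P i ! k) = chan i k (pk \<omega> i) ?Z" if "i < d" "k < length (P i)" for i k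
    using that(2)
  proof (induction k)
    case 0
    then show ?case using Y[of "P i ! 0"] that(1) P_arcs sent_first P_first[of i] source_safe by simp
  next
    case (Suc k)
    then show ?case using Y[of "P i ! Suc k"] that(1) P_arcs[of i "Suc k"] sent_inner by simp
  qed
  show "Y = flow (pk \<omega>) ?Z"
  proof
    fix e
    consider "e \<notin> arcs G" | i k where "i < d" "k < length (P i)" "e = P i ! k"
      | "e \<in> arcs G" "\<And>i k. i < d \<Longrightarrow> k < length (P i) \<Longrightarrow> e \<noteq> P i ! k" by blast
    then show "Y e = flow (pk \<omega>) ?Z e"
    proof cases
      case 1
      then show ?thesis using assms(2) by (auto simp: flow_def PiE_iff extensional_def)
    next
      case 2
      then show ?thesis using on flow_on by simp
    next
      case 3
      then show ?thesis using Y[OF 3(1)] flow_off[OF 3] sent_off[OF 3(2)] by simp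
    qed
  qed
next
  assume Y: "Y = flow (pk \<omega>) ?Z"
  show "transmission J G s t code \<beta> \<phi> \<omega> Y"
    unfolding transmission_def code_simps
  proof (intro conjI assms(2) ballI)
    fix e assume e: "e \<in> arcs G"
    consider i where "i < d" "e = P i ! 0" | i k where "i < d" "Suc k < length (P i)" "e = P i ! Suc k"
      | "\<And>i k. i < d \<Longrightarrow> k < length (P i) \<Longrightarrow> e \<noteq> P i ! k"
      by (metis not0_implies_Suc)
    then show "Y e = (if tail G e \<in> jam_nodes \<beta> then jam J code (sent G s code \<omega> Y e) (?Z e)
      else sent G s code \<omega> Y e)"
    proof cases
      case 1
      then have "Y e = pk \<omega> i" using P_nonempty by (subst Y) (simp add: flow_on)
      then show ?thesis using 1 sent_first P_first source_safe by simp
    next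
      case 2
      have "Y e = chan i (Suc k) (pk \<omega> i) ?Z" "Y (P i ! k) = chan i k (pk \<omega> i) ?Z"
        using 2 by (subst Y, simp add: flow_on del: chan.simps)+
      then show ?thesis using 2 sent_inner by simp
    next
      case 3
      then show ?thesis using e sent_off[OF 3] by (subst Y) (simp add: flow_off)
    qed
  qed
qed

lemma vec_add_in: "x \<in> vecs F n \<Longrightarrow> y \<in> vecs F n \<Longrightarrow> vec_add F n x y \<in> vecs F n"
proof -
  interpret field F by (rule field)
  show "x \<in> vecs F n \<Longrightarrow> y \<in> vecs F n \<Longrightarrow> vec_add F n x y \<in> vecs F n"
    by (auto simp: vecs_def vec_add_def PiE_iff)
qed

lemma jam_in: "x \<in> vecs F n \<Longrightarrow> y \<in> vecs F n \<Longrightarrow> jam J code x y \<in> vecs F n"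
  by (cases J) (auto simp: vec_add_in)

definition inject_ok :: "('e \<Rightarrow> symbols) \<Rightarrow> bool" where
  "inject_ok Z \<longleftrightarrow> (\<forall>e\<in>arcs G. tail G e \<in> jam_nodes \<beta> \<longrightarrow> Z e \<in> vecs F n)"

lemma chan_in: "inject_ok Z \<Longrightarrow> x \<in> vecs F n \<Longrightarrow> i < d \<Longrightarrow> k < length (P i) \<Longrightarrow> chan i k x Z \<in> vecs F n"
  by (induction k) (auto intro!: jam_in simp: inject_ok_def P_arcs)

lemma flow_in:
  assumes "inject_ok Z" "\<And>i. i < d \<Longrightarrow> X i \<in> vecs F n"
  shows "flow X Z \<in> arcs G \<rightarrow>\<^sub>E vecs F n"
proof
  fix e assume e: "e \<in> arcs G"
  consider i k where "i < d" "k < length (P i)" "e = P i ! k"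
    | "\<And>i k. i < d \<Longrightarrow> k < length (P i) \<Longrightarrow> e \<noteq> P i ! k" by blast
  then show "flow X Z e \<in> vecs F n"
  proof cases
    case 1
    then show ?thesis using assms by (simp add: flow_on chan_in)
  next
    case 2
    from flow_off[OF e 2] show ?thesis
      using assms(1) e by (auto simp: inject_ok_def intro!: jam_in zero_vec_in)
  qed
qed (simp add: flow_def)

lemma inject_ok_feedback: "Y \<in> arcs G \<rightarrow>\<^sub>E vecs F n \<Longrightarrow> inject_ok (\<phi> (nodes_info G Y fb))"
proof -
  assume Y: "Y \<in> arcs G \<rightarrow>\<^sub>E vecs F n"
  have "nodes_info G Y fb \<in> (\<Pi>\<^sub>E v\<in>fb. in_arcs G v \<rightarrow>\<^sub>E vecs F n)"
    using Y by (auto simp: nodes_info_def node_info_def in_arcs_def PiE_iff)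
  then show ?thesis using valid by (simp add: valid_strategy_def inject_ok_def)
qed

abbreviation "rcv \<equiv> received J G s t code \<beta> \<phi>"

abbreviation "obs \<omega> \<equiv> nodes_info G (rcv \<omega>) fb"

lemma ex1_transmission: "\<omega> \<in> source_data code \<Longrightarrow> \<exists>!Y. transmission J G s t code \<beta> \<phi> \<omega> Y"
  using valid by (simp add: valid_strategy_def)

lemma transmission_received: "\<omega> \<in> source_data code \<Longrightarrow> transmission J G s t code \<beta> \<phi> \<omega> (rcv \<omega>)"
  unfolding received_def by (rule theI'[OF ex1_transmission])

lemma received_in: "\<omega> \<in> source_data code \<Longrightarrow> rcv \<omega> \<in> arcs G \<rightarrow>\<^sub>E vecs F n"
  using transmission_received[of \<omega>] by (simp add: transmission_def)

lemma received_flow: "\<omega> \<in> source_data code \<Longrightarrow> rcv \<omega> = flow (pk \<omega>) (\<phi> (obs \<omega>))"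
  using transmission_iff_flow[OF _ received_in] transmission_received by blast

lemma obs_flow_cong:
  assumes "\<And>i. i \<in> hit fb \<Longrightarrow> X i = X' i"
  shows "nodes_info G (flow X Z) fb = nodes_info G (flow X' Z) fb"
proof -
  have "flow X Z e = flow X' Z e" if v: "v \<in> fb" "e \<in> in_arcs G v" for v e
  proof (cases "\<exists>i k. i < d \<and> k < length (P i) \<and> e = P i ! k")
    case True
    then obtain i k where e: "i < d" "k < length (P i)" "e = P i ! k" by auto
    \<comment> \<open>Feedback excludes the terminal, so \<open>e\<close> is not the last arc of its
      path; its head is an inner node and the path is hit.\<close>
    have "head G e \<noteq> t" using v by (auto simp: feedback_nodes_def)
    then have "Suc k < length (P i)" using P_last[OF e(1)] e by (metis Suc_lessI diff_Suc_1)
    then have "i \<in> hit fb" using e v P_step[of i k] by (auto simp: hit_def in_arcs_def)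
    then show ?thesis using e assms by (simp add: flow_on)
  next
    case False
    then have "\<And>i k. i < d \<Longrightarrow> k < length (P i) \<Longrightarrow> e \<noteq> P i ! k" by blast
    moreover have "e \<in> arcs G" using v by (simp add: in_arcs_def)
    ultimately show ?thesis by (simp add: flow_off)
  qed
  then show ?thesis by (auto simp: nodes_info_def node_info_def intro!: restrict_ext)
qed

text \<open>Injections may depend on observations further downstream; that the observations are still a function
  of the packets on observed paths follows from the uniqueness of the transmission.\<close>
lemma obs_cong:
  assumes \<omega>: "\<omega> \<in> source_data code" "\<omega>' \<in> source_data code"
    and eq: "\<And>i. i \<in> hit fb \<Longrightarrow> pk \<omega> i = pk \<omega>' i"
  shows "obs \<omega> = obs \<omega>'"
proof -
  \<comment> \<open>The packets of \<open>\<omega>'\<close> meet the injections chosen under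
    \<open>\<omega>\<close>. The feedback read from \<open>Y\<close> equals
    \<open>obs \<omega>\<close>, so \<open>Y\<close> solves the fixed-point equation of
    \<open>\<omega>'\<close>, and uniqueness identifies it.\<close>
  define Y where "Y = flow (pk \<omega>') (\<phi> (obs \<omega>))"
  have "obs \<omega> = nodes_info G (flow (pk \<omega>) (\<phi> (obs \<omega>))) fb" using received_flow[OF \<omega>(1)] by simp
  also have "\<dots> = nodes_info G Y fb" unfolding Y_def by (rule obs_flow_cong) (rule eq)
  finally have o: "obs \<omega> = nodes_info G Y fb" .
  have "Y \<in> arcs G \<rightarrow>\<^sub>E vecs F n" unfolding Y_def
    by (rule flow_in) (use \<omega> in \<open>auto intro!: inject_ok_feedback received_in pk simp: source_data_code\<close>)
  moreover have "Y = flow (pk \<omega>') (\<phi> (nodes_info G Y fb))"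
    unfolding o[symmetric] by (rule Y_def)
  ultimately have "transmission J G s t code \<beta> \<phi> \<omega>' Y"
    using transmission_iff_flow[OF \<omega>(2)] by blast
  then have "rcv \<omega>' = Y" using ex1_transmission[OF \<omega>(2)] transmission_received[OF \<omega>(2)] by blast
  then show ?thesis using o by simp
qed

definition out :: "('v \<Rightarrow> 'e \<Rightarrow> symbols) \<Rightarrow> nat \<Rightarrow> symbols \<Rightarrow> symbols" where
  "out o' i x = chan i (length (P i) - 1) x (\<phi> o')"

lemma received_last:
  assumes "\<omega> \<in> source_data code" "i < d"
  shows "rcv \<omega> (P i ! (length (P i) - 1)) = out (obs \<omega>) i (pk \<omega> i)"
proof -
  have "length (P i) - 1 < length (P i)" using P_nonempty assms by simp
  then show ?thesis unfolding out_def using received_flow[OF assms(1)] flow_on assms by metis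
qed

lemma out_in:
  assumes "\<omega> \<in> source_data code" "i < d" "x \<in> vecs F n"
  shows "out (obs \<omega>) i x \<in> vecs F n"
  unfolding out_def using assms P_nonempty by (intro chan_in inject_ok_feedback received_in) auto

lemma out_unjammed:
  assumes "i < d" "i \<notin> hit (jam_nodes \<beta>)"
  shows "out o' i x = x"
proof -
  have "chan i k x Z = x" if "k < length (P i)" for k Z
    using that by (induction k) (use assms in \<open>auto simp: hit_def\<close>)
  then show ?thesis using P_nonempty assms by (simp add: out_def)
qed

text \<open>With the view fixed, the injections along a path add up to one error
  \<open>\<delta>\<close> that is the same for every packet \<open>x\<close>; the tampering bound
  rests on this order of quantifiers.\<close>

lemma out_additive:
  assumes "J = Additive" "\<omega> \<in> source_data code" "i < d"
  shows "\<exists>\<delta>\<in>vecs F n. \<forall>x\<in>vecs F n. out (obs \<omega>) i x = vec_add F n x \<delta>"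
proof -
  interpret field F by (rule field)
  let ?Z = "\<phi> (obs \<omega>)"
  have jam: "jam J code x y = vec_add F n x y" for x y using assms(1) by simp
  have ok: "inject_ok ?Z" using assms by (intro inject_ok_feedback received_in)
  have "\<exists>\<delta>\<in>vecs F n. \<forall>x\<in>vecs F n. chan i k x ?Z = vec_add F n x \<delta>" if "k < length (P i)" for k
    using that
  proof (induction k)
    case 0
    have "\<forall>x\<in>vecs F n. x = vec_add F n x (zero_vec F n)"
      by (auto simp: vec_add_def zero_vec_def vecs_def PiE_iff extensional_def fun_eq_iff)
    then show ?case using zero_vec_in by auto
  next
    case (Suc k)
    then obtain \<delta> where \<delta>: "\<delta> \<in> vecs F n" "\<forall>x\<in>vecs F n. chan i k x ?Z = vec_add F n x \<delta>" by auto
    show ?case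
    proof (cases "tail G (P i ! Suc k) \<in> jam_nodes \<beta>")
      case True
      then have z: "?Z (P i ! Suc k) \<in> vecs F n" using ok assms Suc.prems by (simp add: inject_ok_def P_arcs)
      have "\<forall>x\<in>vecs F n. vec_add F n (vec_add F n x \<delta>) (?Z (P i ! Suc k)) = vec_add F n x (vec_add F n \<delta> (?Z (P i ! Suc k)))"
        using \<delta>(1) z by (auto simp: vec_add_def vecs_def PiE_iff a_assoc fun_eq_iff)
      then show ?thesis using True \<delta> vec_add_in[OF \<delta>(1) z]
        by (intro bexI[of _ "vec_add F n \<delta> (?Z (P i ! Suc k))"]) (simp_all add: jam)
    next
      case False
      then show ?thesis using \<delta> by auto
    qed
  qed
  then show ?thesis unfolding out_def using P_nonempty assms by simp
qed

end


section \<open>Capacity\<close>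

context network begin

lemma cas_chain:
  assumes "cas u p v" "p \<noteq> []"
  shows "tail G (p ! 0) = u \<and> head G (p ! (length p - 1)) = v \<and>
    (\<forall>k. Suc k < length p \<longrightarrow> tail G (p ! Suc k) = head G (p ! k))"
  using assms
proof (induction p arbitrary: u)
  case (Cons e p)
  show ?case
  proof (cases "p = []")
    case False
    from Cons.prems have "tail G e = u" "cas (head G e) p v" by auto
    with Cons.IH[OF this(2) False] False show ?thesis
      by (auto simp: nth_Cons split: nat.splits)
  qed (use Cons.prems in auto)
qed simp

lemma tail_ne_terminal: "e \<in> arcs G \<Longrightarrow> tail G e \<noteq> t"
  using terminal_no_out_arcs by (auto simp: out_arcs_def)

lemma apath_chain:
  assumes "apath s p t" "p \<noteq> []"
  shows "set p \<subseteq> arcs G" "tail G (p ! 0) = s" "head G (p ! (length p - 1)) = t"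
    "\<And>k. Suc k < length p \<Longrightarrow> tail G (p ! Suc k) = head G (p ! k)"
    "distinct (map (tail G) p)" "set (map (tail G) p) \<subseteq> set (awalk_verts s p)"
  using assms cas_chain[of s p t] by (auto simp: apath_def awalk_def awalk_verts_conv)

text \<open>Exactly \<open>b\<close> of the long paths and \<open>d - b\<close> of the direct edges,
  the latter as one-arc lists, are numbered in an arbitrary order.\<close>

lemma ex_path_system:
  assumes "vertex_connected G s t d"
  shows "\<exists>P. path_system G s t d P"
\<comment> \<open>For \<open>d = 0\<close> the source and terminal may coincide. For positive
  \<open>d\<close> they differ, since otherwise some path or edge would leave
  \<open>t\<close>.\<close>
proof (cases "d = 0")
  case True
  then show ?thesis by (intro exI[of _ "\<lambda>_. []"]) (unfold_locales, auto)
next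
  case False
  obtain b where b: "b \<le> d"
    and ex: "\<exists>Ps. finite Ps \<and> b \<le> card Ps \<and> (\<forall>p\<in>Ps. apath s p t \<and> 2 \<le> length p) \<and>
      (\<forall>p\<in>Ps. \<forall>p'\<in>Ps. p \<noteq> p' \<longrightarrow> set (awalk_verts s p) \<inter> set (awalk_verts s p') \<subseteq> {s, t})"
    and edges: "d - b \<le> card {e \<in> arcs G. tail G e = s \<and> head G e = t}"
    using assms unfolding vertex_connected_def by - (erule exE, (erule conjE)+, rule that; assumption)
  obtain Ps where Ps: "finite Ps" "b \<le> card Ps"
    and path: "\<forall>p\<in>Ps. apath s p t \<and> 2 \<le> length p"
    and disj: "\<forall>p\<in>Ps. \<forall>p'\<in>Ps. p \<noteq> p' \<longrightarrow> set (awalk_verts s p) \<inter> set (awalk_verts s p') \<subseteq> {s, t}"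
    using ex by - (erule exE, (erule conjE)+, rule that; assumption)
  have "s \<noteq> t"
  proof
    assume st: "s = t"
    have "Ps = {}"
    proof (rule ccontr)
      assume "Ps \<noteq> {}"
      then obtain p where p: "apath s p t" "2 \<le> length p" using path by blast
      then have "p \<noteq> []" by auto
      from apath_chain(1,2)[OF p(1) this] have "p ! 0 \<in> arcs G" "tail G (p ! 0) = t"
        using st \<open>p \<noteq> []\<close> by auto
      then show False using tail_ne_terminal by blast
    qed
    then have "card Ps = 0" by simp
    moreover have "{e \<in> arcs G. tail G e = s \<and> head G e = t} = {}" using st tail_ne_terminal by auto
    then have "card {e \<in> arcs G. tail G e = s \<and> head G e = t} = 0" by (simp only: card.empty)
    ultimately show False using Ps(2) edges False by arith
  qed
  obtain Ps0 where Ps0: "Ps0 \<subseteq> Ps" "card Ps0 = b" "finite Ps0" using obtain_subset_with_card_n[OF Ps(2)] by metis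
  obtain D0 where D0: "D0 \<subseteq> {e \<in> arcs G. tail G e = s \<and> head G e = t}" "card D0 = d - b" "finite D0"
    using obtain_subset_with_card_n[OF edges] by metis
  define Q where "Q = Ps0 \<union> (\<lambda>e. [e]) ` D0"
  have "Ps0 \<inter> (\<lambda>e. [e]) ` D0 = {}" using path Ps0 by fastforce
  moreover have "card ((\<lambda>e. [e]) ` D0) = d - b" using D0 by (subst card_image) (auto simp: inj_on_def)
  ultimately have "finite Q" "card Q = d" using Ps0 D0 b by (auto simp: Q_def card_Un_disjoint)
  then obtain P where P: "bij_betw P {0..<d} Q" using ex_bij_betw_nat_finite by metis
  have PQ: "P i \<in> Q" if "i < d" for i using that bij_betwE[OF P] by auto
  have Pinj: "i = j" if "i < d" "j < d" "P i = P j" for i j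
    using that bij_betw_imp_inj_on[OF P] by (auto simp: inj_on_def)
  have long: "p \<in> Ps0" if "p \<in> Q" "Suc k < length p" for p k
    using that by (auto simp: Q_def)
  have Q: "apath s p t" "p \<noteq> []" if p: "p \<in> Q" for p
  proof -
    show "apath s p t"
    proof (cases "p \<in> Ps0")
      case True
      then show ?thesis using path Ps0 by blast
    next
      case False
      then obtain e where "e \<in> D0" "p = [e]" using p by (auto simp: Q_def)
      then show ?thesis using D0 \<open>s \<noteq> t\<close> source_in_verts by (auto simp: apath_def awalk_def)
    qed
    show "p \<noteq> []" using p path Ps0 by (fastforce simp: Q_def)
  qed
  note ch = apath_chain[OF Q]
  \<comment> \<open>The tail in question differs from \<open>s\<close> because tails along an
    \<open>apath\<close> are distinct, and from \<open>t\<close> because no arc leaves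
    \<open>t\<close>; so disjointness outside \<open>{s, t}\<close> applies.\<close>
  have inner: "p = p' \<and> k = k'"
    if p: "p \<in> Q" "p' \<in> Q" "Suc k < length p" "Suc k' < length p'" and eq: "tail G (p ! Suc k) = tail G (p' ! Suc k')" for p p' k k'
  proof -
    let ?v = "tail G (p ! Suc k)"
    have "?v \<noteq> s"
    proof
      assume "?v = s"
      then have "map (tail G) p ! Suc k = map (tail G) p ! 0" using ch(2)[OF p(1) p(1)] Q(2)[OF p(1)] p(3) by simp
      then show False
        using nth_eq_iff_index_eq[OF ch(5)[OF p(1) p(1)], of "Suc k" 0] p(3) Q(2)[OF p(1)] by (simp del: nth_map)
    qed
    moreover have "?v \<noteq> t" using ch(1)[OF p(1) p(1)] p(3) by (intro tail_ne_terminal) auto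
    moreover have "?v \<in> set (awalk_verts s p)" using ch(6)[OF p(1) p(1)] p(3) by auto
    moreover have "?v \<in> set (awalk_verts s p')" unfolding eq using ch(6)[OF p(2) p(2)] p(4) by auto
    ultimately have "p = p'"
      using disj long[OF p(1,3)] long[OF p(2,4)] Ps0 by blast
    moreover from this have "k = k'"
      using eq p nth_eq_iff_index_eq[OF ch(5)[OF p(1) p(1)], of "Suc k" "Suc k'"] by simp
    ultimately show ?thesis ..
  qed
  \<comment> \<open>The first arc ends in \<open>t\<close> exactly for one-arc paths, so both paths
    are of the same kind. One-arc paths are then equal lists; longer ones share their second vertex,
    to which \<open>inner\<close> applies.\<close>
  have first: "p = p'" if p: "p \<in> Q" "p' \<in> Q" and eq: "p ! 0 = p' ! 0" for p p'
  proof -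
    have nt: "head G (q ! 0) \<noteq> t" if "q \<in> Q" "Suc 0 < length q" for q
    proof -
      have "q ! Suc 0 \<in> arcs G" using ch(1)[OF that(1,1)] that(2) nth_mem by blast
      then show ?thesis using ch(4)[OF that(1,1,2)] tail_ne_terminal by metis
    qed
    have one: "length q = 1 \<and> head G (q ! 0) = t" if "q \<in> Q" "\<not> Suc 0 < length q" for q
      using ch(3)[OF that(1,1)] Q(2)[OF that(1)] that(2) by (cases q) auto
    show ?thesis
    proof (cases "Suc 0 < length p")
      case True
      then have l: "Suc 0 < length p'" using nt[OF p(1)] one[OF p(2)] eq by auto
      have "tail G (p ! Suc 0) = tail G (p' ! Suc 0)"
        using ch(4)[OF p(1,1) True] ch(4)[OF p(2,2) l] eq by simp
      then show ?thesis using inner[OF p True l] by simp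
    next
      case False
      then have "\<not> Suc 0 < length p'" using nt[OF p(2)] one[OF p(1)] eq by auto
      then have "length p = 1" "length p' = 1" using one p False by auto
      then show ?thesis using eq by (cases p; cases p') auto
    qed
  qed
  have "path_system G s t d P"
  proof unfold_locales
    fix i assume i: "i < d"
    note q = PQ[OF i]
    show "P i \<noteq> []" by (rule Q(2)[OF q])
    show "P i ! k \<in> arcs G" if "k < length (P i)" for k using ch(1)[OF q q] that by auto
    show "tail G (P i ! 0) = s" by (rule ch(2)[OF q q])
    show "tail G (P i ! Suc k) = head G (P i ! k)" if "Suc k < length (P i)" for k by (rule ch(4)[OF q q that])
    show "head G (P i ! (length (P i) - 1)) = t" by (rule ch(3)[OF q q])
    fix j assume j: "j < d"
    show "i = j" if "P i ! 0 = P j ! 0" using first[OF q PQ[OF j] that] Pinj i j by blast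
    show "i = j \<and> k = k'" if "Suc k < length (P i)" "Suc k' < length (P j)" "tail G (P i ! Suc k) = tail G (P j ! Suc k')" for k k'
      using inner[OF q PQ[OF j] that] Pinj i j by blast
  qed
  then show ?thesis by (intro exI[of _ P])
qed

end

section \<open>Rate, secrecy and reliability as counting statements\<close>

lemma vecs_nonempty_finite:
  assumes "field F" "finite (carrier F)"
  shows "vecs F k \<noteq> {}" "finite (vecs F k)"
proof -
  interpret field F by fact
  have "(\<lambda>_\<in>{..<k}. \<zero>\<^bsub>F\<^esub>) \<in> vecs F k" by (auto simp: vecs_def)
  then show "vecs F k \<noteq> {}" by blast
  show "finite (vecs F k)" unfolding vecs_def using assms by (intro finite_PiE) auto
qed

context routing begin

lemma field_size_gt_1: "1 < card (carrier F)"
proof -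
  interpret field F by (rule field)
  have "card {\<zero>\<^bsub>F\<^esub>, \<one>\<^bsub>F\<^esub>} \<le> card (carrier F)" by (intro card_mono finite_field) auto
  then show ?thesis by simp
qed

lemma source_measure_code: "source_measure code = uniform_count_measure (M \<times> vecs F rl)"
  by (simp add: source_measure_def source_data_code)

lemma rate_code: "rate code = log (real (card (carrier F))) (real (card M)) / real n"
  unfolding rate_def code_entropy_def source_measure_code
  using entropy_fst_uniform[OF M(1) vecs_nonempty_finite(2) M(2) vecs_nonempty_finite(1)] field finite_field field_size_gt_1
  by simp

lemma perfectly_secret_code:
  assumes "\<And>m m' x. m \<in> M \<Longrightarrow> m' \<in> M \<Longrightarrow>
    card {r \<in> vecs F rl. nodes_info G (received J G s t code \<beta> \<phi> (m, r)) (obs_nodes \<beta>) = x}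
     \<le> card {r \<in> vecs F rl. nodes_info G (received J G s t code \<beta> \<phi> (m', r)) (obs_nodes \<beta>) = x}"
  shows "perfectly_secret J G s t code \<beta> \<phi>"
  unfolding perfectly_secret_def code_mutual_information_def source_measure_code
  using field_size_gt_1
  by (intro mutual_information_fst_eq_0 M vecs_nonempty_finite field assms) (simp_all add: finite_field)

lemma reliable_code:
  fixes \<epsilon> :: real
  assumes "card {\<omega> \<in> M \<times> vecs F rl. decode code (node_info G (received J G s t code \<beta> \<phi> \<omega>) t) \<noteq> fst \<omega>}
     \<le> \<epsilon> * card (M \<times> vecs F rl)"
  shows "reliable J G s t code \<beta> \<phi> \<epsilon>"
proof -
  have fin: "finite (M \<times> vecs F rl)" "M \<times> vecs F rl \<noteq> {}"
    using M vecs_nonempty_finite[OF field finite_field] by auto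
  then have "0 < card (M \<times> vecs F rl)" by (simp only: card_gt_0_iff) simp
  moreover have "measure (uniform_count_measure (M \<times> vecs F rl)) E = card E / card (M \<times> vecs F rl)"
    if "E \<subseteq> M \<times> vecs F rl" for E
    using fin(1) that by (rule measure_uniform_count_measure)
  ultimately show ?thesis
    using assms unfolding reliable_def source_measure_code space_uniform_count_measure
    by (simp only: Collect_subset pos_divide_le_eq of_nat_0_less_iff)
qed

end

section \<open>Choice of parameters and the capacity values\<close>

lemma carrier_residue_ring: "carrier (residue_ring m) = {0..<m}"
  by (auto simp: residue_ring_def)

lemma field_residue_ring: "prime p \<Longrightarrow> field (residue_ring (int p))"
proof -
  assume "prime p"
  then interpret residues_prime p "residue_ring (int p)" by unfold_locales
  show ?thesis by (rule is_field)
qed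

text \<open>With a single message and no paths, a constant decoder never errs and the constant
  message is independent of every observation, whatever the adversary does.\<close>

lemma capacity_0:
  assumes "network G s t"
  shows "secure_message_capacity J G B s t 0"
  unfolding secure_message_capacity_def
proof (intro allI impI)
  fix \<epsilon> \<gamma> :: real assume pos: "0 < \<epsilon>" "0 < \<gamma>"
  interpret network G s t by fact
  have "field (residue_ring 2)" using field_residue_ring[of 2] by simp
  moreover have "path_system G s t 0 (\<lambda>_. [])" by unfold_locales auto
  ultimately interpret rt: routing G s t 0 "\<lambda>_. []" "residue_ring 2" 1 0 "{0}" "\<lambda>_ _. undefined" "\<lambda>_. 0"
    by (intro routing.intro routing_axioms.intro) (simp_all add: carrier_residue_ring)
  show "\<exists>c. valid_code G s t c \<and> 0 - \<gamma> \<le> rate c \<and>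
      (\<forall>\<beta>\<in>B. \<forall>\<phi>. valid_strategy J G s t c \<beta> \<phi> \<longrightarrow> reliable J G s t c \<beta> \<phi> \<epsilon> \<and>
         (t \<notin> obs_nodes \<beta> \<longrightarrow> perfectly_secret J G s t c \<beta> \<phi>))"
  proof (intro exI[of _ "rt.code"] conjI ballI allI impI rt.valid_code_code rt.reliable_code rt.perfectly_secret_code)
    show "0 - \<gamma> \<le> rate rt.code" by (subst rt.rate_code) (use pos in simp)
    show "real (card {\<omega> \<in> {0} \<times> vecs (residue_ring 2) 0. decode rt.code (node_info G (received J G s t rt.code \<beta> \<phi> \<omega>) t) \<noteq> fst \<omega>})
          \<le> \<epsilon> * real (card ({0::nat} \<times> vecs (residue_ring 2) 0))" for \<beta> \<phi>
    proof -
      have "{\<omega> \<in> {0} \<times> vecs (residue_ring 2) 0. decode rt.code (node_info G (received J G s t rt.code \<beta> \<phi> \<omega>) t) \<noteq> fst \<omega>} = {}"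
        unfolding rt.code_simps by auto
      then show ?thesis using pos by (simp only: card.empty) simp
    qed
  qed simp
qed

text \<open>The order of choice matters: \<open>L\<close> brings the loss of rate below
  \<open>\<gamma>\<close>, then \<open>p\<close> beats the error numerator for this
  \<open>L\<close>, and \<open>rlen\<close> makes room for all addresses.\<close>

lemma ex_coset_code_parameters:
  fixes \<epsilon> \<gamma> :: real
  assumes "0 < \<epsilon>" "0 < \<gamma>"
  shows "\<exists>p L rlen h. prime (p::nat) \<and> coset_code (int p) d L z R rlen (p ^ (L * R)) h \<and>
    real R - \<gamma> \<le> real (L * R) / real (L + 3 * d + 2) \<and>
    real (d * d * L + d * (L + 2 * d + 2)) \<le> \<epsilon> * real p"
proof -
  \<comment> \<open>With packet length \<open>N = L + 3 * d + 2\<close> the loss is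
    \<open>R - L * R / N = R * (3 * d + 2) / N\<close>, whence the threshold.\<close>
  obtain L :: nat where L: "real R * (3 * real d + 2) / \<gamma> \<le> real L" using real_arch_simple by blast
  have "real R * (3 * real d + 2) \<le> \<gamma> * real L" using L assms by (simp add: field_simps)
  also have "\<dots> \<le> \<gamma> * (real L + 3 * real d + 2)" using assms by (intro mult_left_mono) auto
  finally have "(real R - \<gamma>) * real (L + 3 * d + 2) \<le> real (L * R)"
    by (simp add: algebra_simps)
  moreover have "0 < real (L + 3 * d + 2)" by simp
  ultimately have rate: "real R - \<gamma> \<le> real (L * R) / real (L + 3 * d + 2)"
    by (simp only: pos_le_divide_eq)
  let ?K = "d * d * L + d * (L + 2 * d + 2)"
  obtain q :: nat where q: "real ?K / \<epsilon> \<le> real q" using real_arch_simple by blast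
  obtain p :: nat where p: "prime p" "max q (L + 2 * d + 2) < p" using bigger_prime by blast
  have "real ?K \<le> \<epsilon> * real q" using q assms by (simp add: field_simps)
  also have "\<dots> \<le> \<epsilon> * real p" using p assms by (intro mult_left_mono) auto
  finally have err: "real ?K \<le> \<epsilon> * real p" .
  \<comment> \<open>One range for all roles: the first index is a row below \<open>L\<close> or a
    path below \<open>d\<close>, the second a coefficient below \<open>z\<close>, a path below
    \<open>d\<close>, or 0.\<close>
  define I where "I = (\<lambda>(t, i, j). idx t i j) ` ({..<4} \<times> {..<L + d} \<times> {..<z + d + 1})"
  have "finite I" by (simp add: I_def)
  then obtain rlen where rlen: "\<forall>n\<in>I. n < rlen" using finite_nat_set_iff_bounded by blast
  have "finite (({..<L} \<times> {..<R}) \<rightarrow>\<^sub>E {0..<int p})" by (intro finite_PiE) auto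
  then obtain h where "bij_betw h {0..<card (({..<L} \<times> {..<R}) \<rightarrow>\<^sub>E {0..<int p})} (({..<L} \<times> {..<R}) \<rightarrow>\<^sub>E {0..<int p})"
    using ex_bij_betw_nat_finite by blast
  moreover have "card (({..<L} \<times> {..<R}) \<rightarrow>\<^sub>E {0..<int p}) = p ^ (L * R)"
    by (subst card_PiE) auto
  ultimately have h: "bij_betw h {..<p ^ (L * R)} (({..<L} \<times> {..<R}) \<rightarrow>\<^sub>E {0..<int p})"
    by (simp add: lessThan_atLeast0)
  have "coset_code (int p) d L z R rlen (p ^ (L * R)) h"
  proof
    show "idx t i j < rlen" if "t < 4" "i < L + d" "j < z + d + 1" for t i j
      using rlen that by (force simp: I_def)
  qed (use p h in auto)
  then show ?thesis using p(1) rate err by blast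
qed

lemma routing_coset_code:
  fixes p rlen :: nat
  assumes "path_system G s t d P" "prime p" "coset_code (int p) d L z R rlen M h"
  shows "routing G s t d P (residue_ring (int p)) (L + 3 * d + 2) rlen {..<M}
    (coset_code.packet (int p) d L z R h) (coset_code.dec (int p) d L z R rlen M h)"
proof -
  interpret cc: coset_code "int p" d L z R rlen M h by fact
  show ?thesis
  proof (intro routing.intro routing_axioms.intro assms(1) field_residue_ring assms(2))
    show "{..<M} \<noteq> {}" using cc.dec_in_msgs by blast
    show "cc.packet \<omega> i \<in> vecs (residue_ring (int p)) (L + 3 * d + 2)"
      if "\<omega> \<in> {..<M} \<times> vecs (residue_ring (int p)) rlen" "i < d" for \<omega> i
      using cc.packet_in_vecs[of \<omega> i] that by (simp only: vecs_def carrier_residue_ring)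
  qed (use cc.dec_in_msgs in \<open>simp_all add: carrier_residue_ring\<close>)
qed

text \<open>In the union, nodes both observed and corrupted count once; this bound yields the
  overwrite threshold.\<close>

lemma card_configs:
  assumes "\<beta> \<in> configs G s l_o l_e l_oe"
  shows "card (obs_nodes \<beta>) \<le> l_o + l_oe" "card (jam_nodes \<beta>) \<le> l_e + l_oe"
    "card (obs_nodes \<beta> \<union> jam_nodes \<beta>) \<le> l_o + l_e + l_oe"
proof -
  obtain bo be boe where b: "\<beta> = (bo, be, boe)" by (cases \<beta>)
  then have c: "card bo \<le> l_o" "card be \<le> l_e" "card boe \<le> l_oe" using assms by (auto simp: configs_def)
  show "card (obs_nodes \<beta>) \<le> l_o + l_oe" "card (jam_nodes \<beta>) \<le> l_e + l_oe"
    using c card_Un_le[of bo boe] card_Un_le[of be boe] b by auto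
  have "obs_nodes \<beta> \<union> jam_nodes \<beta> = (bo \<union> be) \<union> boe" using b by auto
  then show "card (obs_nodes \<beta> \<union> jam_nodes \<beta>) \<le> l_o + l_e + l_oe"
    using c card_Un_le[of "bo \<union> be" boe] card_Un_le[of bo be] by simp
qed

text \<open>Identifies the network attack with the abstract one: the view is the information at the
  feedback nodes, seen and altered packets are those on paths hit by feedback and jammed nodes, and
  \<open>at.out\<close> is the resulting map on each path.\<close>

lemma routed_coset_code_secure:
  fixes p rlen :: nat and \<epsilon> :: real
  assumes ps: "path_system G s t d P" and p: "prime p" "coset_code (int p) d L (l_o + l_oe) R rlen M h"
    and R: "R = d - (l_o + l_oe) - (l_e + l_oe)" "0 < R"
    and J: "J = Additive \<or> l_o + 2 * l_e + 2 * l_oe < d"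
    and \<epsilon>: "real (d * d * L + d * (L + 2 * d + 2)) \<le> \<epsilon> * real p"
    and \<beta>: "\<beta> \<in> configs G s l_o l_e l_oe"
  defines "c \<equiv> routing.code d P (residue_ring (int p)) (L + 3 * d + 2) rlen {..<M}
    (coset_code.packet (int p) d L (l_o + l_oe) R h) (coset_code.dec (int p) d L (l_o + l_oe) R rlen M h)"
  assumes valid: "valid_strategy J G s t c \<beta> \<phi>"
  shows "reliable J G s t c \<beta> \<phi> \<epsilon>" and "t \<notin> obs_nodes \<beta> \<Longrightarrow> perfectly_secret J G s t c \<beta> \<phi>"
proof -
  interpret cc: coset_code "int p" d L "l_o + l_oe" R rlen M h by fact
  interpret rt: routing G s t d P "residue_ring (int p)" "L + 3 * d + 2" rlen "{..<M}" cc.packet cc.dec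
    by (rule routing_coset_code[OF ps p])
  interpret at: attack G s t d P "residue_ring (int p)" "L + 3 * d + 2" rlen "{..<M}" cc.packet cc.dec J \<beta> \<phi>
    using \<beta> valid by unfold_locales (auto simp: configs_def c_def)
  have vecs: "vecs (residue_ring (int p)) k = {..<k} \<rightarrow>\<^sub>E {0..<int p}" for k
    by (simp only: vecs_def carrier_residue_ring)
  have sd: "source_data rt.code = cc.\<Omega>" unfolding rt.source_data_code vecs ..
  have fin: "finite (obs_nodes \<beta>)" "finite (jam_nodes \<beta>)"
    using \<beta> by (auto simp: configs_def intro!: finite_subset[OF _ rt.finite_verts])
  have A: "card (rt.hit at.fb) \<le> l_o + l_oe"
    using rt.card_hit_le[of at.fb] fin card_mono[of "obs_nodes \<beta>" at.fb] card_configs(1)[OF \<beta>]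
    by (auto simp: feedback_nodes_def)
  have B: "card (rt.hit (jam_nodes \<beta>)) \<le> l_e + l_oe"
    using rt.card_hit_le[of "jam_nodes \<beta>"] fin card_configs(2)[OF \<beta>] by auto
  interpret ac: attacked_code "int p" d L "l_o + l_oe" R rlen M h "rt.hit at.fb" "rt.hit (jam_nodes \<beta>)" at.obs at.out
  proof (unfold_locales, goal_cases)
    case 6
    then show ?case by (intro at.obs_cong) (simp_all only: sd)
  next
    case (7 \<omega> i x)
    then show ?case using at.out_in[of \<omega> i x] by (simp only: sd vecs)
  next
    case 8
    then show ?case by (rule at.out_unjammed)
  qed (use rt.hit_subset A B R in auto)
  have mode: "(\<forall>\<omega>\<in>cc.\<Omega>. \<forall>i<d. \<exists>\<delta>. \<forall>x\<in>{..<L + 3 * d + 2} \<rightarrow>\<^sub>E {0..<int p}. \<forall>n<L + 3 * d + 2.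
      at.out (at.obs \<omega>) i x n = (x n + \<delta> n) mod int p)
    \<or> card (rt.hit at.fb \<union> rt.hit (jam_nodes \<beta>)) < l_o + l_oe + R"
    using J
  proof
    assume J: "J = Additive"
    have "\<exists>\<delta>. \<forall>x\<in>{..<L + 3 * d + 2} \<rightarrow>\<^sub>E {0..<int p}. \<forall>n<L + 3 * d + 2. at.out (at.obs \<omega>) i x n = (x n + \<delta> n) mod int p"
      if "\<omega> \<in> cc.\<Omega>" "i < d" for \<omega> i
      using at.out_additive[OF J, of \<omega> i] that unfolding sd vecs
      by (auto simp: vec_add_def residue_ring_def)
    then show ?thesis by blast
  next
    assume "l_o + 2 * l_e + 2 * l_oe < d"
    moreover have "card (rt.hit at.fb \<union> rt.hit (jam_nodes \<beta>)) \<le> card (at.fb \<union> jam_nodes \<beta>)"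
      unfolding rt.hit_Un[symmetric] using fin by (intro rt.card_hit_le) (auto simp: feedback_nodes_def)
    moreover have "card (at.fb \<union> jam_nodes \<beta>) \<le> card (obs_nodes \<beta> \<union> jam_nodes \<beta>)"
      using fin by (intro card_mono) (auto simp: feedback_nodes_def)
    \<comment> \<open>The number of coefficients per row is \<open>d - l_e - l_oe\<close>, so the
      overwrite hypothesis says that it exceeds \<open>l_o + l_e + l_oe\<close>.\<close>
    ultimately have "card (rt.hit at.fb \<union> rt.hit (jam_nodes \<beta>)) < l_o + l_oe + R"
      using card_configs(3)[OF \<beta>] R by linarith
    then show ?thesis ..
  qed
  have dec: "decode c (node_info G (received J G s t c \<beta> \<phi> \<omega>) t) = cc.dec (ac.y \<omega>)" if \<omega>: "\<omega> \<in> cc.\<Omega>" for \<omega>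
    unfolding c_def rt.code_simps
  proof (rule cc.dec_cong)
    fix i assume i: "i < d"
    then have "P i ! (length (P i) - 1) \<in> in_arcs G t"
      using rt.P_nonempty rt.P_last rt.P_arcs by (simp add: in_arcs_def)
    then have "node_info G (at.rcv \<omega>) t (P i ! (length (P i) - 1)) = at.rcv \<omega> (P i ! (length (P i) - 1))"
      by (simp only: node_info_def restrict_apply')
    also have "\<dots> = ac.y \<omega> i" unfolding ac.y_def by (rule at.received_last) (use \<omega> i sd in auto)
    finally show "node_info G (at.rcv \<omega>) t (P i ! (length (P i) - 1)) = ac.y \<omega> i" .
  qed
  have "{\<omega> \<in> cc.\<Omega>. decode c (node_info G (received J G s t c \<beta> \<phi> \<omega>) t) \<noteq> fst \<omega>} = {\<omega> \<in> cc.\<Omega>. cc.dec (ac.y \<omega>) \<noteq> fst \<omega>}"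
    by (intro Collect_cong conj_cong refl) (simp only: dec)
  moreover have "real (card {\<omega> \<in> cc.\<Omega>. cc.dec (ac.y \<omega>) \<noteq> fst \<omega>}) * real p \<le> \<epsilon> * real p * real (card cc.\<Omega>)"
  proof -
    have "real (card {\<omega> \<in> cc.\<Omega>. cc.dec (ac.y \<omega>) \<noteq> fst \<omega>} * p) \<le> real ((d * d * L + d * (L + 2 * d + 2)) * card cc.\<Omega>)"
      using ac.decoding_error_bound[OF mode] by (simp only: nat_int of_nat_le_iff)
    also have "\<dots> = real (d * d * L + d * (L + 2 * d + 2)) * real (card cc.\<Omega>)" by (rule of_nat_mult)
    also have "\<dots> \<le> \<epsilon> * real p * real (card cc.\<Omega>)" by (intro mult_right_mono \<epsilon>) simp
    finally show ?thesis by (simp only: of_nat_mult)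
  qed
  ultimately have "real (card {\<omega> \<in> cc.\<Omega>. decode c (node_info G (received J G s t c \<beta> \<phi> \<omega>) t) \<noteq> fst \<omega>}) * real p
      \<le> \<epsilon> * real (card cc.\<Omega>) * real p"
    by (simp only: mult_ac)
  moreover have "0 < real p" using p(1) prime_gt_0_nat by simp
  ultimately have "real (card {\<omega> \<in> cc.\<Omega>. decode c (node_info G (received J G s t c \<beta> \<phi> \<omega>) t) \<noteq> fst \<omega>}) \<le> \<epsilon> * real (card cc.\<Omega>)"
    by (simp only: mult_le_cancel_right_pos)
  then show "reliable J G s t c \<beta> \<phi> \<epsilon>"
    unfolding c_def by (intro rt.reliable_code) (simp only: vecs)
  show "perfectly_secret J G s t c \<beta> \<phi>" if "t \<notin> obs_nodes \<beta>"
    unfolding c_def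
  proof (rule rt.perfectly_secret_code)
    fix m m' x assume m: "m \<in> {..<M}" "m' \<in> {..<M}"
    \<comment> \<open>With the terminal unobserved, the feedback is the whole observation whose
      secrecy is claimed.\<close>
    have fb: "at.fb = obs_nodes \<beta>" using that by (auto simp: feedback_nodes_def)
    have "card {r \<in> cc.V. at.obs (m, r) = x} \<le> card {r \<in> cc.V. at.obs (m', r) = x}"
      by (rule cc.secrecy[OF ac.A _ _ ac.obs_cong]) (use m in simp_all)
    then show "card {r \<in> vecs (residue_ring (int p)) rlen. nodes_info G (at.rcv (m, r)) (obs_nodes \<beta>) = x}
        \<le> card {r \<in> vecs (residue_ring (int p)) rlen. nodes_info G (at.rcv (m', r)) (obs_nodes \<beta>) = x}"
      by (simp only: fb vecs)
  qed
qed

lemma capacity_pos: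
  assumes ps: "path_system G s t d P" and d: "l_o + l_e + 2 * l_oe < d"
    and J: "J = Additive \<or> l_o + 2 * l_e + 2 * l_oe < d"
  shows "secure_message_capacity J G (configs G s l_o l_e l_oe) s t (real d - real l_o - real l_e - 2 * real l_oe)"
  unfolding secure_message_capacity_def
proof (intro allI impI)
  fix \<epsilon> \<gamma> :: real assume pos: "0 < \<epsilon>" "0 < \<gamma>"
  \<comment> \<open>By the hypothesis on \<open>d\<close>, the subtraction of naturals does not
    truncate.\<close>
  define R where "R = d - (l_o + l_oe) - (l_e + l_oe)"
  have R: "0 < R" "real R = real d - real l_o - real l_e - 2 * real l_oe"
    using d by (auto simp: R_def)
  obtain p L rlen h where p: "prime (p::nat)" and cc: "coset_code (int p) d L (l_o + l_oe) R rlen (p ^ (L * R)) h"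
    and rate: "real R - \<gamma> \<le> real (L * R) / real (L + 3 * d + 2)"
    and err: "real (d * d * L + d * (L + 2 * d + 2)) \<le> \<epsilon> * real p"
    using ex_coset_code_parameters[OF pos] by blast
  interpret rt: routing G s t d P "residue_ring (int p)" "L + 3 * d + 2" rlen "{..<p ^ (L * R)}"
    "coset_code.packet (int p) d L (l_o + l_oe) R h" "coset_code.dec (int p) d L (l_o + l_oe) R rlen (p ^ (L * R)) h"
    by (rule routing_coset_code[OF ps p cc])
  have "log (real p) (real (p ^ (L * R))) = real (L * R)"
    using prime_gt_1_nat[OF p] by (simp add: log_nat_power)
  then have "rate rt.code = real (L * R) / real (L + 3 * d + 2)"
    by (simp only: rt.rate_code carrier_residue_ring card_lessThan) simp
  then show "\<exists>c. valid_code G s t c \<and> real d - real l_o - real l_e - 2 * real l_oe - \<gamma> \<le> rate c \<and>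
      (\<forall>\<beta>\<in>configs G s l_o l_e l_oe. \<forall>\<phi>. valid_strategy J G s t c \<beta> \<phi> \<longrightarrow> reliable J G s t c \<beta> \<phi> \<epsilon> \<and>
         (t \<notin> obs_nodes \<beta> \<longrightarrow> perfectly_secret J G s t c \<beta> \<phi>))"
    using rate R rt.valid_code_code routed_coset_code_secure[OF ps p cc R_def R(1) J err]
    by (intro exI[of _ rt.code]) (simp add: R(2))
qed

theorem mainTheorem3:
  fixes G :: "('v, 'e) pre_digraph" and s t :: 'v and d l_o l_e l_oe :: nat
  assumes "network G s t"
    and "vertex_connected G s t d"
  shows
        "secure_message_capacity Additive G (configs G s l_o l_e l_oe) s t
           (if d > l_o + l_e + 2 * l_oe
            then real d - real l_o - real l_e - 2 * real l_oe else 0) \<and>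
         secure_message_capacity Overwrite G (configs G s l_o l_e l_oe) s t
           (if d > l_o + 2 * l_e + 2 * l_oe
            then real d - real l_o - real l_e - 2 * real l_oe else 0)"
proof -
  obtain P where P: "path_system G s t d P"
    using network.ex_path_system[OF assms] by blast
  have add: "secure_message_capacity Additive G (configs G s l_o l_e l_oe) s t (real d - real l_o - real l_e - 2 * real l_oe)"
    if "l_o + l_e + 2 * l_oe < d"
    by (rule capacity_pos[OF P that]) simp
  \<comment> \<open>The overwrite threshold implies the additive one, so both conditions of
    \<open>capacity_pos\<close> hold.\<close>
  have ow: "secure_message_capacity Overwrite G (configs G s l_o l_e l_oe) s t (real d - real l_o - real l_e - 2 * real l_oe)"
    if "l_o + 2 * l_e + 2 * l_oe < d"
    by (rule capacity_pos[OF P]) (use that in auto)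
  show ?thesis using add ow capacity_0[OF assms(1)] by simp
qed

end
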